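(* Let $m\ge2$. For every $n\in\mathbb{N}$, $$\mathfrak{F}_n\le\left(\frac{n\cdot n!}{4^{n-1}}\right)^{1/n},$$ and in particular $\mathfrak{F}_3\le 3^{2/3}/2=1.04004\ldots$.
   Context: For a non-empty open $\Omega\subset\mathbb{R}^m$ with $|\Omega|<\infty$, $\lambda_1(\Omega)=\inf_{\varphi\in H_0^1(\Omega)\setminus\{0\}}\int_\Omega|D\varphi|^2/\int_\Omega\varphi^2$, $v_\Omega$ is the unique solution of $-\Delta v=1$, $v\in H_0^1(\Omega)$, $F_p(\Omega)=\|v_\Omega\|_{L^p(\Omega)}\lambda_1(\Omega)/|\Omega|^{1/p}$, and $\mathfrak{F}_p=\sup\{F_p(\Omega):\Omega\text{ open in }\mathbb{R}^m,\ 0<|\Omega|<\infty\}$. *)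

theory Defs
  imports "HOL-Analysis.Analysis"
begin

definition partial_deriv :: "(real^'m \<Rightarrow> real) \<Rightarrow> 'm \<Rightarrow> real^'m \<Rightarrow> real" where
  "partial_deriv f i x = frechet_derivative f (at x) (axis i 1)"

definition grad :: "(real^'m \<Rightarrow> real) \<Rightarrow> real^'m \<Rightarrow> real^'m" where
  "grad f x = (\<chi> i. partial_deriv f i x)"

fun Ck :: "nat \<Rightarrow> (real^'m \<Rightarrow> real) \<Rightarrow> bool" where
  "Ck 0 f = continuous_on UNIV f"
| "Ck (Suc k) f = ((\<forall>x. f differentiable (at x)) \<and> (\<forall>i. Ck k (partial_deriv f i)))"

definition smooth_fun :: "(real^'m \<Rightarrow> real) \<Rightarrow> bool" where
  "smooth_fun f = (\<forall>k. Ck k f)"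

definition tsupport :: "(real^'m \<Rightarrow> real) \<Rightarrow> (real^'m) set" where
  "tsupport f = closure {x. f x \<noteq> 0}"

definition test_fun :: "(real^'m) set \<Rightarrow> (real^'m \<Rightarrow> real) \<Rightarrow> bool" where
  "test_fun \<Omega> f = (smooth_fun f \<and> compact (tsupport f) \<and> tsupport f \<subseteq> \<Omega>)"

text \<open>H01 Omega phi G: \<phi> (a function on R^m, i.e. extended by zero outside \<Omega>)
  belongs to H_0^1(\<Omega>), the closure of C_c^\<infinity>(\<Omega>) in the H^1 norm, and G is its
  (weak) gradient: there are test functions \<phi>_k with \<phi>_k \<rightarrow> \<phi> and D\<phi>_k \<rightarrow> G in L^2.\<close>
definition H01 :: "(real^'m) set \<Rightarrow> (real^'m \<Rightarrow> real) \<Rightarrow> (real^'m \<Rightarrow> real^'m) \<Rightarrow> bool" where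
  "H01 \<Omega> \<phi> G = (\<phi> \<in> borel_measurable lebesgue \<and> G \<in> borel_measurable lebesgue \<and>
     (\<exists>\<psi> :: nat \<Rightarrow> real^'m \<Rightarrow> real. (\<forall>k. test_fun \<Omega> (\<psi> k)) \<and>
        (\<lambda>k. \<integral>\<^sup>+ x. ennreal ((\<psi> k x - \<phi> x)\<^sup>2) \<partial>lebesgue) \<longlonglongrightarrow> 0 \<and>
        (\<lambda>k. \<integral>\<^sup>+ x. ennreal ((norm (grad (\<psi> k) x - G x))\<^sup>2) \<partial>lebesgue) \<longlonglongrightarrow> 0))"

definition lambda1 :: "(real^'m) set \<Rightarrow> real" where
  "lambda1 \<Omega> = Inf {(\<integral>x\<in>\<Omega>. (norm (G x))\<^sup>2 \<partial>lebesgue) / (\<integral>x\<in>\<Omega>. (\<phi> x)\<^sup>2 \<partial>lebesgue)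
       | \<phi> G. H01 \<Omega> \<phi> G \<and> (\<integral>\<^sup>+x\<in>\<Omega>. ennreal ((\<phi> x)\<^sup>2) \<partial>lebesgue) \<noteq> 0}"

text \<open>Weak solution of -\<Delta>v = 1, v \<in> H_0^1(\<Omega>).\<close>
definition is_torsion :: "(real^'m) set \<Rightarrow> (real^'m \<Rightarrow> real) \<Rightarrow> bool" where
  "is_torsion \<Omega> v = (\<exists>G. H01 \<Omega> v G \<and>
     (\<forall>\<phi> H. H01 \<Omega> \<phi> H \<longrightarrow>
        (\<integral>x\<in>\<Omega>. G x \<bullet> H x \<partial>lebesgue) = (\<integral>x\<in>\<Omega>. \<phi> x \<partial>lebesgue)))"

text \<open>v_\<Omega> (unique up to null sets; any choice gives the same L^p norms).\<close>
definition torsion :: "(real^'m) set \<Rightarrow> real^'m \<Rightarrow> real" where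
  "torsion \<Omega> = (SOME v. is_torsion \<Omega> v)"

definition Lp_norm :: "real \<Rightarrow> (real^'m) set \<Rightarrow> (real^'m \<Rightarrow> real) \<Rightarrow> real" where
  "Lp_norm p \<Omega> v = (enn2real (\<integral>\<^sup>+x\<in>\<Omega>. ennreal (\<bar>v x\<bar> powr p) \<partial>lebesgue)) powr (1 / p)"

definition F_fun :: "real \<Rightarrow> (real^'m) set \<Rightarrow> real" where
  "F_fun p \<Omega> = Lp_norm p \<Omega> (torsion \<Omega>) * lambda1 \<Omega> / (measure lebesgue \<Omega>) powr (1 / p)"

text \<open>\<frak>F_p, the supremum over open sets of finite positive measure in R^m
  (taken in the extended reals, so that it is meaningful even if unbounded).
  The dimension m is the cardinality of the index type 'm.\<close>
definition frakF :: "('m::finite) itself \<Rightarrow> real \<Rightarrow> ereal" where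
  "frakF _ p = Sup {ereal (F_fun p (\<Omega> :: (real^'m) set)) | \<Omega>.
       open \<Omega> \<and> 0 < emeasure lebesgue \<Omega> \<and> emeasure lebesgue \<Omega> < \<infinity>}"

end

theory Submission
  imports Defs
begin

text \<open>
  Let \<open>v\<close> be the torsion function with gradient \<open>G\<close>. If \<open>g' = w\<close> and \<open>h' = w\<^sup>2\<close> with
  \<open>g 0 = h 0 = 0\<close>, then testing the Rayleigh quotient with \<open>g(v)\<close> and the torsion equation
  with \<open>h(v)\<close> gives \<open>\<lambda>\<^sub>1 \<integral> g(v)\<^sup>2 \<le> \<integral> w(v)\<^sup>2 |G|\<^sup>2 = \<integral> h(v)\<close>. Taking \<open>w(t)\<close> close to
  \<open>(p/2) |t|^(p/2 - 1)\<close> yields \<open>\<lambda>\<^sub>1 \<integral> |v|^p \<le> p\<^sup>2 / (4 (p - 1)) \<integral> |v|^(p - 1)\<close> for \<open>p \<ge> 2\<close>,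
  without any sign information on \<open>v\<close>. Iterating from \<open>p = n\<close> down to \<open>\<lambda>\<^sub>1 \<integral> |v| \<le> |\<Omega>|\<close>, which is
  Cauchy-Schwarz, gives the bound. If \<open>\<lambda>\<^sub>1 \<le> 0\<close> there is nothing to prove; otherwise \<open>\<lambda>\<^sub>1 > 0\<close> is
  itself a Poincare inequality, and the torsion function exists as the limit of a minimizing
  sequence of \<open>\<integral> |D\<phi>|\<^sup>2 / 2 - \<integral> \<phi>\<close> over the test functions.
\<close>

section \<open>Square-integrable functions\<close>

definition L2_sq :: "'a measure \<Rightarrow> ('a \<Rightarrow> 'b::real_normed_vector) \<Rightarrow> ennreal" where
  "L2_sq M f = (\<integral>\<^sup>+x. ennreal ((norm (f x))\<^sup>2) \<partial>M)"

definition square_integrable :: "'a measure \<Rightarrow> ('a \<Rightarrow> 'b::real_normed_vector) \<Rightarrow> bool" where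
  "square_integrable M f \<longleftrightarrow> f \<in> borel_measurable M \<and> L2_sq M f < \<infinity>"

definition L2_tendsto ::
  "'a measure \<Rightarrow> (nat \<Rightarrow> 'a \<Rightarrow> 'b::real_normed_vector) \<Rightarrow> ('a \<Rightarrow> 'b) \<Rightarrow> bool" where
  "L2_tendsto M f g \<longleftrightarrow> (\<lambda>k. L2_sq M (\<lambda>x. f k x - g x)) \<longlonglongrightarrow> 0"

definition L2_Cauchy :: "'a measure \<Rightarrow> (nat \<Rightarrow> 'a \<Rightarrow> 'b::real_normed_vector) \<Rightarrow> bool" where
  "L2_Cauchy M f \<longleftrightarrow>
     (\<forall>e>0. \<exists>N. \<forall>k\<ge>N. \<forall>l\<ge>N. L2_sq M (\<lambda>x. f k x - f l x) \<le> ennreal e)"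

lemma square_integrable_measurable [measurable_dest]:
  "square_integrable M f \<Longrightarrow> f \<in> borel_measurable M"
  by (simp add: square_integrable_def)

lemma square_integrable_iff_integrable:
  "square_integrable M f \<longleftrightarrow> f \<in> borel_measurable M \<and> integrable M (\<lambda>x. (norm (f x))\<^sup>2)"
  by (auto simp: square_integrable_def L2_sq_def integrable_iff_bounded)

lemma L2_sq_eq_integral:
  "square_integrable M f \<Longrightarrow> L2_sq M f = ennreal (\<integral>x. (norm (f x))\<^sup>2 \<partial>M)"
  by (auto simp: square_integrable_iff_integrable L2_sq_def intro: nn_integral_eq_integral)

lemma L2_sq_le_of_norm_le:
  assumes "g \<in> borel_measurable M" "\<And>x. norm (f x) \<le> B * norm (g x)"
  shows "L2_sq M f \<le> ennreal (B\<^sup>2) * L2_sq M g"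
proof -
  have "L2_sq M f \<le> (\<integral>\<^sup>+x. ennreal (B\<^sup>2) * ennreal ((norm (g x))\<^sup>2) \<partial>M)"
    unfolding L2_sq_def
    using power_mono[OF assms(2) norm_ge_zero, of _ 2]
    by (intro nn_integral_mono) (simp add: ennreal_leI power_mult_distrib flip: ennreal_mult)
  also have "\<dots> = ennreal (B\<^sup>2) * L2_sq M g"
    unfolding L2_sq_def using assms(1) by (intro nn_integral_cmult) measurable
  finally show ?thesis .
qed

lemma L2_sq_add_le:
  fixes f g :: "'a \<Rightarrow> 'b::{real_normed_vector, second_countable_topology}"
  assumes [measurable]: "f \<in> borel_measurable M" "g \<in> borel_measurable M"
  shows "L2_sq M (\<lambda>x. f x + g x) \<le> 2 * L2_sq M f + 2 * L2_sq M g"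
proof -
  have "(norm (a + b))\<^sup>2 \<le> 2 * (norm a)\<^sup>2 + 2 * (norm b)\<^sup>2" for a b :: 'b
    using power_mono[OF norm_triangle_ineq[of a b], of 2] sum_squares_bound[of "norm a" "norm b"]
    by (simp add: power2_sum)
  then have "L2_sq M (\<lambda>x. f x + g x)
      \<le> (\<integral>\<^sup>+x. 2 * ennreal ((norm (f x))\<^sup>2) + 2 * ennreal ((norm (g x))\<^sup>2) \<partial>M)"
    unfolding L2_sq_def
    by (intro nn_integral_mono)
      (simp add: ennreal_leI flip: ennreal_numeral ennreal_mult ennreal_plus)
  also have "\<dots> = 2 * L2_sq M f + 2 * L2_sq M g"
    unfolding L2_sq_def by (simp add: nn_integral_add nn_integral_cmult)
  finally show ?thesis .
qed

lemma L2_sq_restrict_space_le: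
  assumes "A \<in> sets M"
  shows "L2_sq (restrict_space M A) f \<le> L2_sq M f"
  unfolding L2_sq_def using assms
  by (subst nn_integral_restrict_space) (auto intro!: nn_integral_mono simp: indicator_def)

lemma L2_sq_restrict_space_eq:
  assumes "A \<in> sets M" "\<And>x. x \<notin> A \<Longrightarrow> f x = 0"
  shows "L2_sq (restrict_space M A) f = L2_sq M f"
  unfolding L2_sq_def using assms
  by (subst nn_integral_restrict_space) (auto intro!: nn_integral_cong simp: indicator_def)

lemma square_integrable_norm_le:
  assumes "square_integrable M f" "g \<in> borel_measurable M" "\<And>x. norm (g x) \<le> B * norm (f x)"
  shows "square_integrable M g"
  using L2_sq_le_of_norm_le[of f M g B] assms
  by (auto simp: square_integrable_def ennreal_mult_less_top intro: order_le_less_trans)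

lemma square_integrable_add:
  fixes f g :: "'a \<Rightarrow> 'b::{real_normed_vector, second_countable_topology}"
  assumes "square_integrable M f" "square_integrable M g"
  shows "square_integrable M (\<lambda>x. f x + g x)"
  using L2_sq_add_le[of f M g] assms
  by (auto simp: square_integrable_def ennreal_mult_less_top intro: order_le_less_trans)

lemma square_integrable_diff:
  fixes f g :: "'a \<Rightarrow> 'b::{real_normed_vector, second_countable_topology}"
  assumes "square_integrable M f" "square_integrable M g"
  shows "square_integrable M (\<lambda>x. f x - g x)"
proof -
  have "square_integrable M (\<lambda>x. - g x)"
    by (rule square_integrable_norm_le[OF assms(2), where B = 1]) (use assms in measurable)
  from square_integrable_add[OF assms(1) this] show ?thesis by simp
qed

lemma square_integrable_restrict_space:
  assumes "square_integrable M f" "A \<in> sets M"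
  shows "square_integrable (restrict_space M A) f"
  using assms L2_sq_restrict_space_le[OF assms(2), of f]
  by (auto simp: square_integrable_def measurable_restrict_space1)

lemma (in finite_measure) square_integrable_const: "square_integrable M (\<lambda>_. c)"
  by (simp add: square_integrable_iff_integrable)

lemma square_integrable_imp_integrable_inner:
  fixes f g :: "'a \<Rightarrow> 'b::{real_inner, second_countable_topology}"
  assumes "square_integrable M f" "square_integrable M g"
  shows "integrable M (\<lambda>x. f x \<bullet> g x)"
proof (rule Bochner_Integration.integrable_bound)
  show "integrable M (\<lambda>x. (norm (f x))\<^sup>2 + (norm (g x))\<^sup>2)"
    using assms by (simp add: square_integrable_iff_integrable)
  have "\<bar>a \<bullet> b\<bar> \<le> (norm a)\<^sup>2 + (norm b)\<^sup>2" for a b :: 'b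
    using Cauchy_Schwarz_ineq2[of a b] sum_squares_bound[of "norm a" "norm b"]
      mult_nonneg_nonneg[of "norm a" "norm b"] by simp
  then show "AE x in M. norm (f x \<bullet> g x) \<le> norm ((norm (f x))\<^sup>2 + (norm (g x))\<^sup>2)"
    by simp
qed (use assms in measurable)

lemma nonneg_quadratic_imp_discriminant_nonpos:
  fixes a b c :: real
  assumes nonneg: "\<And>t. 0 \<le> a * t\<^sup>2 + b * t + c" and "0 \<le> a"
  shows "b\<^sup>2 \<le> 4 * a * c"
proof (cases "a = 0")
  case True
  have "b = 0"
  proof (rule ccontr)
    assume "b \<noteq> 0"
    then show False using nonneg[of "- (c + 1) / b"] True by simp
  qed
  with True show ?thesis by simp
next
  case False
  with \<open>0 \<le> a\<close> have "0 < a" by simp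
  then show ?thesis
    using nonneg[of "- b / (2 * a)"] by (simp add: field_simps power2_eq_square)
qed

lemma integral_inner_Cauchy_Schwarz:
  fixes f g :: "'a \<Rightarrow> 'b::{real_inner, second_countable_topology}"
  assumes f: "square_integrable M f" and g: "square_integrable M g"
  shows "(\<integral>x. f x \<bullet> g x \<partial>M)\<^sup>2 \<le> (\<integral>x. (norm (f x))\<^sup>2 \<partial>M) * (\<integral>x. (norm (g x))\<^sup>2 \<partial>M)"
proof -
  let ?F = "\<integral>x. (norm (f x))\<^sup>2 \<partial>M" and ?I = "\<integral>x. f x \<bullet> g x \<partial>M" and ?G = "\<integral>x. (norm (g x))\<^sup>2 \<partial>M"
  note [simp] = square_integrable_imp_integrable_inner[OF f g]
  have [simp]: "integrable M (\<lambda>x. (norm (f x))\<^sup>2)" "integrable M (\<lambda>x. (norm (g x))\<^sup>2)"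
    using assms by (simp_all add: square_integrable_iff_integrable)
  have "0 \<le> ?G * t\<^sup>2 + 2 * ?I * t + ?F" for t
  proof -
    have "0 \<le> (\<integral>x. (norm (f x + t *\<^sub>R g x))\<^sup>2 \<partial>M)" by simp
    also have "\<dots> = (\<integral>x. (norm (f x))\<^sup>2 + 2 * t * (f x \<bullet> g x) + t\<^sup>2 * (norm (g x))\<^sup>2 \<partial>M)"
      unfolding power2_norm_eq_inner
      by (intro Bochner_Integration.integral_cong)
        (simp_all add: inner_add inner_commute algebra_simps power2_eq_square)
    also have "\<dots> = ?G * t\<^sup>2 + 2 * ?I * t + ?F" by simp
    finally show ?thesis .
  qed
  then have "(2 * ?I)\<^sup>2 \<le> 4 * ?G * ?F" by (rule nonneg_quadratic_imp_discriminant_nonpos) simp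
  then show ?thesis by (simp add: power_mult_distrib mult.commute)
qed

lemma (in finite_measure) square_integrable_imp_integrable:
  fixes f :: "'a \<Rightarrow> real"
  assumes "square_integrable M f"
  shows "integrable M f"
  using square_integrable_imp_integrable_inner[OF square_integrable_const[of 1] assms] by simp

lemma (in finite_measure) integral_sq_le:
  fixes f :: "'a \<Rightarrow> real"
  assumes "square_integrable M f"
  shows "(\<integral>x. f x \<partial>M)\<^sup>2 \<le> measure M (space M) * (\<integral>x. (f x)\<^sup>2 \<partial>M)"
  using integral_inner_Cauchy_Schwarz[OF square_integrable_const[of 1] assms] by simp

section \<open>Convergence in mean square\<close>

lemma L2_tendsto_subseq:
  assumes "L2_tendsto M f g" "strict_mono r"
  shows "L2_tendsto M (\<lambda>k. f (r k)) g"
  using LIMSEQ_subseq_LIMSEQ[OF assms(1)[unfolded L2_tendsto_def] assms(2)]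
  by (simp add: L2_tendsto_def o_def)

lemma L2_tendsto_norm_le:
  assumes "L2_tendsto M f g" "\<And>k. (\<lambda>x. f k x - g x) \<in> borel_measurable M"
    and "\<And>k x. norm (f' k x - g' x) \<le> B * norm (f k x - g x)"
  shows "L2_tendsto M f' g'"
  unfolding L2_tendsto_def
proof (rule tendsto_sandwich[OF _ _ tendsto_const])
  show "(\<lambda>k. ennreal (B\<^sup>2) * L2_sq M (\<lambda>x. f k x - g x)) \<longlonglongrightarrow> 0"
    using ennreal_tendsto_cmult[of "ennreal (B\<^sup>2)" _ 0] assms(1) by (simp add: L2_tendsto_def)
  show "\<forall>\<^sub>F k in sequentially.
      L2_sq M (\<lambda>x. f' k x - g' x) \<le> ennreal (B\<^sup>2) * L2_sq M (\<lambda>x. f k x - g x)"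
    using L2_sq_le_of_norm_le[OF assms(2,3)] by simp
qed simp

lemma L2_tendsto_restrict_space:
  assumes "L2_tendsto M f g" "A \<in> sets M"
  shows "L2_tendsto (restrict_space M A) f g"
  unfolding L2_tendsto_def
proof (rule tendsto_sandwich[OF _ _ tendsto_const])
  show "(\<lambda>k. L2_sq M (\<lambda>x. f k x - g x)) \<longlonglongrightarrow> 0"
    using assms(1) by (simp add: L2_tendsto_def)
  show "\<forall>\<^sub>F k in sequentially.
      L2_sq (restrict_space M A) (\<lambda>x. f k x - g x) \<le> L2_sq M (\<lambda>x. f k x - g x)"
    by (intro always_eventually allI L2_sq_restrict_space_le assms(2))
qed simp

lemma L2_tendsto_imp_square_integrable:
  fixes g :: "'a \<Rightarrow> 'b::{real_normed_vector, second_countable_topology}"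
  assumes lim: "L2_tendsto M f g" and f: "\<And>k. square_integrable M (f k)"
    and g: "g \<in> borel_measurable M"
  shows "square_integrable M g"
proof -
  have "\<forall>\<^sub>F k in sequentially. L2_sq M (\<lambda>x. f k x - g x) < \<infinity>"
    using order_tendstoD(2)[OF lim[unfolded L2_tendsto_def], of \<infinity>] by simp
  then obtain k where "L2_sq M (\<lambda>x. f k x - g x) < \<infinity>"
    by (auto simp: eventually_sequentially)
  then have "square_integrable M (\<lambda>x. f k x - g x)"
    using f[of k] g by (auto simp: square_integrable_def)
  from square_integrable_diff[OF f[of k] this] show ?thesis by simp
qed

lemma L2_tendsto_imp_integral_tendsto:
  fixes f :: "nat \<Rightarrow> 'a \<Rightarrow> 'b::{real_normed_vector, second_countable_topology}"
  assumes lim: "L2_tendsto M f g" and f: "\<And>k. square_integrable M (f k)"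
    and g: "g \<in> borel_measurable M"
  shows "(\<lambda>k. \<integral>x. (norm (f k x - g x))\<^sup>2 \<partial>M) \<longlonglongrightarrow> 0"
proof -
  note g_square = L2_tendsto_imp_square_integrable[OF lim f g]
  have "(\<lambda>k. ennreal (\<integral>x. (norm (f k x - g x))\<^sup>2 \<partial>M)) \<longlonglongrightarrow> ennreal 0"
    using lim
    by (simp add: L2_tendsto_def L2_sq_eq_integral[OF square_integrable_diff[OF f g_square]])
  then show ?thesis by (subst (asm) tendsto_ennreal_iff) auto
qed

lemma L2_tendsto_inner:
  fixes f :: "nat \<Rightarrow> 'a \<Rightarrow> 'b::{real_inner, second_countable_topology}"
  assumes lim: "L2_tendsto M f g" and f: "\<And>k. square_integrable M (f k)"
    and g: "g \<in> borel_measurable M" and h: "square_integrable M h"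
  shows "(\<lambda>k. \<integral>x. h x \<bullet> f k x \<partial>M) \<longlonglongrightarrow> (\<integral>x. h x \<bullet> g x \<partial>M)"
proof -
  note g_square = L2_tendsto_imp_square_integrable[OF lim f g]
  have diff: "(\<integral>x. h x \<bullet> (f k x - g x) \<partial>M) = (\<integral>x. h x \<bullet> f k x \<partial>M) - (\<integral>x. h x \<bullet> g x \<partial>M)" for k
    using square_integrable_imp_integrable_inner[OF h] f g_square by (simp add: inner_diff_right)
  have "(\<lambda>k. (\<integral>x. h x \<bullet> (f k x - g x) \<partial>M)\<^sup>2) \<longlonglongrightarrow> 0"
  proof (rule tendsto_sandwich[OF _ _ tendsto_const])
    show "(\<lambda>k. (\<integral>x. (norm (h x))\<^sup>2 \<partial>M) * (\<integral>x. (norm (f k x - g x))\<^sup>2 \<partial>M)) \<longlonglongrightarrow> 0"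
      by (rule tendsto_mult_right_zero[OF L2_tendsto_imp_integral_tendsto[OF lim f g]])
    show "\<forall>\<^sub>F k in sequentially. (\<integral>x. h x \<bullet> (f k x - g x) \<partial>M)\<^sup>2
        \<le> (\<integral>x. (norm (h x))\<^sup>2 \<partial>M) * (\<integral>x. (norm (f k x - g x))\<^sup>2 \<partial>M)"
      using integral_inner_Cauchy_Schwarz[OF h square_integrable_diff[OF f g_square]] by simp
  qed simp
  then show ?thesis by (simp add: diff LIM_zero_iff)
qed

lemma L2_tendsto_AE_subseq:
  fixes f :: "nat \<Rightarrow> 'a \<Rightarrow> 'b::{real_normed_vector, second_countable_topology}"
  assumes lim: "L2_tendsto M f g" and f: "\<And>k. square_integrable M (f k)"
    and g: "g \<in> borel_measurable M"
  obtains r :: "nat \<Rightarrow> nat" where "strict_mono r" "AE x in M. (\<lambda>k. f (r k) x) \<longlonglongrightarrow> g x"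
proof -
  have "integrable M (\<lambda>x. (norm (f k x - g x))\<^sup>2)" for k
    using square_integrable_diff[OF f L2_tendsto_imp_square_integrable[OF lim f g]]
    by (simp add: square_integrable_iff_integrable)
  moreover have "(\<lambda>k. \<integral>x. norm ((norm (f k x - g x))\<^sup>2) \<partial>M) \<longlonglongrightarrow> 0"
    using L2_tendsto_imp_integral_tendsto[OF lim f g] by simp
  ultimately obtain r where "strict_mono r"
    and null: "AE x in M. (\<lambda>k. (norm (f (r k) x - g x))\<^sup>2) \<longlonglongrightarrow> 0"
    using tendsto_L1_AE_subseq[of M "\<lambda>k x. (norm (f k x - g x))\<^sup>2"] by blast
  from null have "AE x in M. (\<lambda>k. f (r k) x) \<longlonglongrightarrow> g x"
    by eventually_elim (simp add: LIM_zero_iff tendsto_norm_zero_iff)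
  with \<open>strict_mono r\<close> show thesis by (rule that)
qed

lemma L2_tendsto_add:
  fixes f f' :: "nat \<Rightarrow> 'a \<Rightarrow> 'b::{real_normed_vector, second_countable_topology}"
  assumes [measurable]: "\<And>k. f k \<in> borel_measurable M" "\<And>k. f' k \<in> borel_measurable M"
      "g \<in> borel_measurable M" "g' \<in> borel_measurable M"
    and lim: "L2_tendsto M f g" "L2_tendsto M f' g'"
  shows "L2_tendsto M (\<lambda>k x. f k x + f' k x) (\<lambda>x. g x + g' x)"
  unfolding L2_tendsto_def
proof (rule tendsto_sandwich[OF _ _ tendsto_const])
  have "(\<lambda>k. 2 * L2_sq M (\<lambda>x. f k x - g x) + 2 * L2_sq M (\<lambda>x. f' k x - g' x)) \<longlonglongrightarrow> 2 * 0 + 2 * 0"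
    using lim by (intro tendsto_add ennreal_tendsto_cmult) (simp_all add: L2_tendsto_def)
  then show "(\<lambda>k. 2 * L2_sq M (\<lambda>x. f k x - g x) + 2 * L2_sq M (\<lambda>x. f' k x - g' x)) \<longlonglongrightarrow> 0"
    by simp
  have "L2_sq M (\<lambda>x. f k x + f' k x - (g x + g' x))
      \<le> 2 * L2_sq M (\<lambda>x. f k x - g x) + 2 * L2_sq M (\<lambda>x. f' k x - g' x)" for k
    using L2_sq_add_le[of "\<lambda>x. f k x - g x" M "\<lambda>x. f' k x - g' x"] by (simp add: add_diff_add)
  then show "\<forall>\<^sub>F k in sequentially. L2_sq M (\<lambda>x. f k x + f' k x - (g x + g' x))
      \<le> 2 * L2_sq M (\<lambda>x. f k x - g x) + 2 * L2_sq M (\<lambda>x. f' k x - g' x)"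
    by simp
qed simp

lemma L2_tendsto_dominated:
  fixes f :: "nat \<Rightarrow> 'a \<Rightarrow> 'b::{real_normed_vector, second_countable_topology}"
  assumes [measurable]: "\<And>k. f k \<in> borel_measurable M" "g \<in> borel_measurable M"
    and w: "square_integrable M w" and bound: "\<And>k x. norm (f k x - g x) \<le> norm (w x)"
    and lim: "AE x in M. (\<lambda>k. f k x) \<longlonglongrightarrow> g x"
  shows "L2_tendsto M f g"
proof -
  have [measurable]: "w \<in> borel_measurable M" using w by measurable
  have "(\<lambda>k. \<integral>\<^sup>+x. ennreal ((norm (f k x - g x))\<^sup>2) \<partial>M) \<longlonglongrightarrow> (\<integral>\<^sup>+x. 0 \<partial>M)"
  proof (rule nn_integral_dominated_convergence[where w = "\<lambda>x. ennreal ((norm (w x))\<^sup>2)"])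
    show "(\<integral>\<^sup>+x. ennreal ((norm (w x))\<^sup>2) \<partial>M) < \<infinity>"
      using w by (simp add: square_integrable_def L2_sq_def)
    show "AE x in M. ennreal ((norm (f k x - g x))\<^sup>2) \<le> ennreal ((norm (w x))\<^sup>2)" for k
      using bound by (intro AE_I2 ennreal_leI power_mono) auto
    show "AE x in M. (\<lambda>k. ennreal ((norm (f k x - g x))\<^sup>2)) \<longlonglongrightarrow> 0"
      using lim
    proof eventually_elim
      case (elim x)
      then have "(\<lambda>k. (norm (f k x - g x))\<^sup>2) \<longlonglongrightarrow> 0"
        by (simp add: LIM_zero_iff tendsto_norm_zero_iff)
      from tendsto_ennrealI[OF this] show ?case by simp
    qed
  qed measurable
  then show ?thesis by (simp add: L2_tendsto_def L2_sq_def)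
qed

lemma L2_tendsto_bounded_scaleR:
  fixes f :: "nat \<Rightarrow> 'a \<Rightarrow> 'b::{real_normed_vector, second_countable_topology}"
  assumes lim: "L2_tendsto M f g" and g: "square_integrable M g"
    and [measurable]: "\<And>k. f k \<in> borel_measurable M" "\<And>k. c k \<in> borel_measurable M"
      "d \<in> borel_measurable M"
    and bound: "\<And>k x. \<bar>c k x\<bar> \<le> B" "\<And>x. \<bar>d x\<bar> \<le> B"
    and c: "AE x in M. (\<lambda>k. c k x) \<longlonglongrightarrow> d x"
  shows "L2_tendsto M (\<lambda>k x. c k x *\<^sub>R f k x) (\<lambda>x. d x *\<^sub>R g x)"
proof -
  have [measurable]: "g \<in> borel_measurable M" using g by measurable
  have "L2_tendsto M (\<lambda>k x. c k x *\<^sub>R (f k x - g x)) (\<lambda>x. 0)"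
    using bound(1) by (intro L2_tendsto_norm_le[OF lim, where B = B]) (auto intro: mult_right_mono)
  moreover have "L2_tendsto M (\<lambda>k x. c k x *\<^sub>R g x) (\<lambda>x. d x *\<^sub>R g x)"
  proof (rule L2_tendsto_dominated[where w = "\<lambda>x. (2 * B) *\<^sub>R g x"])
    show "square_integrable M (\<lambda>x. (2 * B) *\<^sub>R g x)"
      by (rule square_integrable_norm_le[OF g, where B = "\<bar>2 * B\<bar>"]) auto
    show "norm (c k x *\<^sub>R g x - d x *\<^sub>R g x) \<le> norm ((2 * B) *\<^sub>R g x)" for k x
      using bound(1)[of k x] bound(2)[of x]
      by (simp flip: scaleR_diff_left add: mult_right_mono)
    show "AE x in M. (\<lambda>k. c k x *\<^sub>R g x) \<longlonglongrightarrow> d x *\<^sub>R g x"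
      using c by eventually_elim (intro tendsto_intros)
  qed measurable
  ultimately have
    "L2_tendsto M (\<lambda>k x. c k x *\<^sub>R (f k x - g x) + c k x *\<^sub>R g x) (\<lambda>x. 0 + d x *\<^sub>R g x)"
    by (intro L2_tendsto_add) measurable
  then show ?thesis by (simp add: scaleR_diff_right)
qed

section \<open>Completeness of the space of square-integrable functions\<close>

lemma convergent_if_summable_weighted_norm_sq:
  fixes y :: "nat \<Rightarrow> 'b::banach"
  assumes "summable (\<lambda>k. 4 ^ k * (norm (y (Suc k) - y k))\<^sup>2)"
  shows "convergent y"
proof -
  have "norm (y (Suc k) - y k) \<le> (1/4) ^ k + 4 ^ k * (norm (y (Suc k) - y k))\<^sup>2" for k
  proof -
    let ?d = "norm (y (Suc k) - y k)"
    have "?d \<le> 2 * ((1/2) ^ k * (2 ^ k * ?d))" by (simp add: power_one_over)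
    also have "\<dots> \<le> ((1/2) ^ k)\<^sup>2 + (2 ^ k * ?d)\<^sup>2"
      using sum_squares_bound[of "(1/2) ^ k" "2 ^ k * ?d"] by simp
    also have "\<dots> = (1/4) ^ k + 4 ^ k * ?d\<^sup>2"
      by (simp add: power_mult_distrib power2_eq_square flip: power_mult_distrib)
    finally show ?thesis .
  qed
  then have "summable (\<lambda>k. y (Suc k) - y k)"
    by (intro summable_comparison_test
        [OF _ summable_add[OF summable_geometric[of "1/4"] assms]]) auto
  then have "convergent (\<lambda>n. y n - y 0)"
    by (simp add: summable_iff_convergent sum_lessThan_telescope)
  then have "convergent (\<lambda>n. (y n - y 0) + y 0)"
    by (intro convergent_add convergent_const)
  then show ?thesis by simp
qed

lemma L2_Cauchy_fast_subseq:
  assumes "L2_Cauchy M f" and "\<And>k. 0 < d k"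
  obtains r where "strict_mono r"
    "\<And>k. L2_sq M (\<lambda>x. f (r (Suc k)) x - f (r k) x) \<le> ennreal (d k)"
proof -
  have "\<exists>N. \<forall>k\<ge>N. \<forall>l\<ge>N. L2_sq M (\<lambda>x. f k x - f l x) \<le> ennreal (d n)" for n
    using assms by (auto simp: L2_Cauchy_def)
  then obtain N where N: "\<And>n k l. N n \<le> k \<Longrightarrow> N n \<le> l \<Longrightarrow>
      L2_sq M (\<lambda>x. f k x - f l x) \<le> ennreal (d n)"
    by metis
  define r where "r n = (\<Sum>i\<le>n. N i) + n" for n
  have "strict_mono r" by (simp add: strict_mono_Suc_iff r_def)
  moreover have "N n \<le> r n" for n
    using member_le_sum[of n "{..n}" N] by (simp add: r_def)
  ultimately show thesis
    using that N by (metis lessI less_imp_le order_trans strict_mono_less_eq)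
qed

lemma AE_convergent_if_L2_sq_diff_le:
  fixes f :: "nat \<Rightarrow> 'a \<Rightarrow> 'b::{banach, second_countable_topology}"
  assumes [measurable]: "\<And>k. f k \<in> borel_measurable M"
    and le: "\<And>k. L2_sq M (\<lambda>x. f (Suc k) x - f k x) \<le> ennreal ((1/8) ^ k)"
  shows "AE x in M. convergent (\<lambda>k. f k x)"
proof -
  define S where "S x = (\<Sum>k. ennreal (4 ^ k * (norm (f (Suc k) x - f k x))\<^sup>2))" for x
  have [measurable]: "S \<in> borel_measurable M" unfolding S_def by measurable
  have "(\<integral>\<^sup>+x. S x \<partial>M) = (\<Sum>k. \<integral>\<^sup>+x. ennreal (4 ^ k * (norm (f (Suc k) x - f k x))\<^sup>2) \<partial>M)"
    unfolding S_def by (intro nn_integral_suminf) measurable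
  also have "\<dots> = (\<Sum>k. ennreal (4 ^ k) * L2_sq M (\<lambda>x. f (Suc k) x - f k x))"
    by (simp add: L2_sq_def ennreal_mult nn_integral_cmult)
  also have "\<dots> \<le> (\<Sum>k. ennreal (4 ^ k) * ennreal ((1/8) ^ k))"
    by (intro suminf_le mult_left_mono le) auto
  also have "\<dots> = ennreal (\<Sum>k. (1/2) ^ k)"
    by (subst suminf_ennreal2[symmetric])
      (auto intro: summable_geometric simp flip: ennreal_mult power_mult_distrib)
  finally have "(\<integral>\<^sup>+x. S x \<partial>M) \<noteq> \<infinity>" by (auto simp: top_unique)
  then have "AE x in M. S x \<noteq> \<infinity>" by (intro nn_integral_PInf_AE) auto
  then show ?thesis
  proof eventually_elim
    case (elim x)
    then show ?case
      unfolding S_def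
      by (intro convergent_if_summable_weighted_norm_sq summable_suminf_not_top) auto
  qed
qed

lemma L2_sq_diff_le_of_AE_tendsto:
  fixes f :: "nat \<Rightarrow> 'a \<Rightarrow> 'b::{real_normed_vector, second_countable_topology}"
  assumes [measurable]: "\<And>k. f k \<in> borel_measurable M" "h \<in> borel_measurable M"
    and lim: "AE x in M. (\<lambda>k. f k x) \<longlonglongrightarrow> g x"
    and le: "\<forall>\<^sub>F k in sequentially. L2_sq M (\<lambda>x. h x - f k x) \<le> C"
  shows "L2_sq M (\<lambda>x. h x - g x) \<le> C"
proof -
  have "AE x in M. ennreal ((norm (h x - g x))\<^sup>2) = liminf (\<lambda>k. ennreal ((norm (h x - f k x))\<^sup>2))"
    using lim
  proof eventually_elim
    case (elim x)
    show ?case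
      by (intro lim_imp_Liminf[symmetric] tendsto_ennrealI tendsto_intros elim) simp
  qed
  then have "L2_sq M (\<lambda>x. h x - g x) = (\<integral>\<^sup>+x. liminf (\<lambda>k. ennreal ((norm (h x - f k x))\<^sup>2)) \<partial>M)"
    unfolding L2_sq_def by (rule nn_integral_cong_AE)
  also have "\<dots> \<le> liminf (\<lambda>k. L2_sq M (\<lambda>x. h x - f k x))"
    unfolding L2_sq_def by (intro nn_integral_liminf) measurable
  also have "\<dots> \<le> C" using Liminf_mono[OF le] by (simp add: Liminf_const)
  finally show ?thesis .
qed

theorem L2_complete:
  fixes f :: "nat \<Rightarrow> 'a \<Rightarrow> 'b::{banach, second_countable_topology}"
  assumes [measurable]: "\<And>k. f k \<in> borel_measurable M" and Cauchy: "L2_Cauchy M f"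
  obtains g where "g \<in> borel_measurable M" "L2_tendsto M f g"
proof -
  obtain r where r: "strict_mono r"
      "\<And>k. L2_sq M (\<lambda>x. f (r (Suc k)) x - f (r k) x) \<le> ennreal ((1/8) ^ k)"
    using L2_Cauchy_fast_subseq[OF Cauchy, of "\<lambda>k. (1/8) ^ k"] by auto
  define g where "g x = lim (\<lambda>k. f (r k) x)" for x
  have "AE x in M. convergent (\<lambda>k. f (r k) x)"
    using r(2) by (rule AE_convergent_if_L2_sq_diff_le[rotated]) measurable
  then have lim: "AE x in M. (\<lambda>k. f (r k) x) \<longlonglongrightarrow> g x"
    by eventually_elim (simp add: g_def convergent_LIMSEQ_iff)
  have "L2_tendsto M f g"
    unfolding L2_tendsto_def
  proof (rule order_tendstoI)
    fix a :: ennreal assume "0 < a"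
    then obtain b where b: "0 < b" "b < a" using dense by blast
    then obtain e where "b = ennreal e" by (cases b) auto
    with b have e: "0 < e" "ennreal e < a" by auto
    obtain N where N: "\<And>k l. N \<le> k \<Longrightarrow> N \<le> l \<Longrightarrow> L2_sq M (\<lambda>x. f k x - f l x) \<le> ennreal e"
      using Cauchy e(1) unfolding L2_Cauchy_def by blast
    have "L2_sq M (\<lambda>x. f k x - g x) \<le> ennreal e" if "N \<le> k" for k
    proof (rule L2_sq_diff_le_of_AE_tendsto[OF _ _ lim])
      show "\<forall>\<^sub>F j in sequentially. L2_sq M (\<lambda>x. f k x - f (r j) x) \<le> ennreal e"
        unfolding eventually_sequentially
        using N[OF that] seq_suble[OF r(1)] by (meson order_trans)
    qed measurable
    then show "\<forall>\<^sub>F k in sequentially. L2_sq M (\<lambda>x. f k x - g x) < a"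
      unfolding eventually_sequentially using e(2) by (meson order_le_less_trans)
  qed simp
  moreover have "g \<in> borel_measurable M" unfolding g_def by measurable
  ultimately show thesis using that by blast
qed

section \<open>Smooth functions and test functions\<close>

lemma partial_deriv_eq:
  assumes "(f has_derivative D) (at x)"
  shows "partial_deriv f i x = D (axis i 1)"
  using frechet_derivative_at[OF assms] by (simp add: partial_deriv_def)

lemma partial_deriv_add:
  assumes "f differentiable at x" "g differentiable at x"
  shows "partial_deriv (\<lambda>x. f x + g x) i x = partial_deriv f i x + partial_deriv g i x"
  using partial_deriv_eq[OF has_derivative_add[OF assms[unfolded frechet_derivative_works]]]
  by (simp add: partial_deriv_def)

lemma partial_deriv_mult:
  assumes "f differentiable at x" "g differentiable at x"
  shows "partial_deriv (\<lambda>x. f x * g x) i x = f x * partial_deriv g i x + partial_deriv f i x * g x"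
  using partial_deriv_eq[OF has_derivative_mult[OF assms[unfolded frechet_derivative_works]]]
  by (simp add: partial_deriv_def)

lemma has_derivative_comp_real:
  assumes "f differentiable at x" "DERIV g (f x) :> d"
  shows "((\<lambda>x. g (f x)) has_derivative (\<lambda>h. d * frechet_derivative f (at x) h)) (at x)"
  using has_derivative_compose[OF assms(1)[unfolded frechet_derivative_works]
      assms(2)[unfolded has_field_derivative_def]]
  by simp

lemma partial_deriv_comp:
  assumes "f differentiable at x" "DERIV g (f x) :> d"
  shows "partial_deriv (\<lambda>x. g (f x)) i x = d * partial_deriv f i x"
  using partial_deriv_eq[OF has_derivative_comp_real[OF assms]] by (simp add: partial_deriv_def)

lemma grad_comp:
  assumes "f differentiable at x" "DERIV g (f x) :> d"
  shows "grad (\<lambda>x. g (f x)) x = d *\<^sub>R grad f x"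
  using partial_deriv_comp[OF assms] by (simp add: grad_def vec_eq_iff)

lemma grad_add_scaled:
  assumes f: "f differentiable at x" and g: "g differentiable at x"
  shows "grad (\<lambda>x. f x + c * g x) x = grad f x + c *\<^sub>R grad g x"
proof -
  have "(\<lambda>x. c * g x) differentiable at x" using g by (intro derivative_intros) auto
  moreover have "partial_deriv (\<lambda>x. c * g x) i x = c * partial_deriv g i x" for i
    by (rule partial_deriv_comp[OF g]) (auto intro!: derivative_eq_intros)
  ultimately show ?thesis
    using f by (simp add: grad_def vec_eq_iff partial_deriv_add)
qed

lemma Ck_const: "Ck k (\<lambda>x. c)"
proof (induction k arbitrary: c)
  case (Suc k)
  have "partial_deriv (\<lambda>x. c) i = (\<lambda>x. 0)" for i :: 'a
    by (auto simp: partial_deriv_def)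
  with Suc show ?case by simp
qed simp

lemma Ck_Suc_imp_Ck: "Ck (Suc k) f \<Longrightarrow> Ck k f"
proof (induction k arbitrary: f)
  case 0
  then show ?case
    by (auto intro!: differentiable_imp_continuous_on
        simp: differentiable_on_def differentiable_at_withinI)
qed auto

lemma Ck_add: "Ck k f \<Longrightarrow> Ck k g \<Longrightarrow> Ck k (\<lambda>x. f x + g x)"
proof (induction k arbitrary: f g)
  case (Suc k)
  have "partial_deriv (\<lambda>x. f x + g x) i = (\<lambda>x. partial_deriv f i x + partial_deriv g i x)" for i
    using Suc.prems by (auto simp: partial_deriv_add)
  with Suc show ?case by simp
qed (simp add: continuous_on_add)

lemma Ck_mult: "Ck k f \<Longrightarrow> Ck k g \<Longrightarrow> Ck k (\<lambda>x. f x * g x)"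
proof (induction k arbitrary: f g)
  case (Suc k)
  have "partial_deriv (\<lambda>x. f x * g x) i
      = (\<lambda>x. f x * partial_deriv g i x + partial_deriv f i x * g x)" for i
    using Suc.prems by (auto simp: partial_deriv_mult)
  moreover have "Ck k (\<lambda>x. f x * partial_deriv g i x + partial_deriv f i x * g x)" for i
    using Suc.prems Ck_Suc_imp_Ck[OF Suc.prems(1)] Ck_Suc_imp_Ck[OF Suc.prems(2)]
    by (intro Ck_add Suc.IH) simp_all
  ultimately show ?case using Suc.prems by simp
qed (simp add: continuous_on_mult)

fun Ck_real :: "nat \<Rightarrow> (real \<Rightarrow> real) \<Rightarrow> bool" where
  "Ck_real 0 f = continuous_on UNIV f"
| "Ck_real (Suc k) f = (\<exists>f'. (\<forall>x. DERIV f x :> f' x) \<and> Ck_real k f')"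

definition smooth_real :: "(real \<Rightarrow> real) \<Rightarrow> bool" where
  "smooth_real f \<longleftrightarrow> (\<forall>k. Ck_real k f)"

lemma Ck_real_const: "Ck_real k (\<lambda>x. c)"
proof (induction k arbitrary: c)
  case (Suc k)
  from Suc[of 0] show ?case by (auto intro!: exI[of _ "\<lambda>x. 0"])
qed simp

lemma Ck_real_ident: "Ck_real k (\<lambda>x. x)"
  by (cases k) (auto intro!: exI[of _ "\<lambda>x. 1"] Ck_real_const)

lemma Ck_real_Suc_imp_Ck_real: "Ck_real (Suc k) f \<Longrightarrow> Ck_real k f"
proof (induction k arbitrary: f)
  case 0
  then obtain f' where "\<And>x. DERIV f x :> f' x" by auto
  then show ?case by (auto intro: DERIV_isCont continuous_at_imp_continuous_on)
qed auto

lemma Ck_real_add: "Ck_real k f \<Longrightarrow> Ck_real k g \<Longrightarrow> Ck_real k (\<lambda>x. f x + g x)"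
proof (induction k arbitrary: f g)
  case (Suc k)
  then obtain f' g' where "\<And>x. DERIV f x :> f' x" "Ck_real k f'"
      and "\<And>x. DERIV g x :> g' x" "Ck_real k g'"
    by auto
  with Suc.IH show ?case by (auto intro!: exI[of _ "\<lambda>x. f' x + g' x"] DERIV_add)
qed (simp add: continuous_on_add)

lemma Ck_real_mult: "Ck_real k f \<Longrightarrow> Ck_real k g \<Longrightarrow> Ck_real k (\<lambda>x. f x * g x)"
proof (induction k arbitrary: f g)
  case (Suc k)
  from Suc.prems obtain f' g' where f': "\<And>x. DERIV f x :> f' x" "Ck_real k f'"
      and g': "\<And>x. DERIV g x :> g' x" "Ck_real k g'"
    by auto
  have "Ck_real k (\<lambda>x. f' x * g x + g' x * f x)"
    using f'(2) g'(2) Suc.prems[THEN Ck_real_Suc_imp_Ck_real] by (intro Ck_real_add Suc.IH)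
  with f'(1) g'(1) show ?case
    by (auto intro!: exI[of _ "\<lambda>x. f' x * g x + g' x * f x"] DERIV_mult)
qed (simp add: continuous_on_mult)

lemma Ck_real_powr:
  assumes "Ck_real k f" and pos: "\<And>x. 0 < f x"
  shows "Ck_real k (\<lambda>x. f x powr a)"
  using assms(1)
proof (induction k arbitrary: a)
  case 0
  have "f x \<noteq> 0" for x using pos[of x] by simp
  with 0 show ?case by (auto intro: continuous_on_powr continuous_intros)
next
  case (Suc k)
  then obtain f' where f': "\<And>x. DERIV f x :> f' x" "Ck_real k f'" by auto
  have "DERIV (\<lambda>x. f x powr a) x :> a * f x powr (a - 1) * f' x" for x
    using DERIV_chain2[OF has_real_derivative_powr[OF pos] f'(1)] .
  moreover have "Ck_real k (\<lambda>x. a * f x powr (a - 1) * f' x)"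
    using Ck_real_Suc_imp_Ck_real[OF Suc.prems] f'(2)
    by (intro Ck_real_mult Ck_real_const Suc.IH)
  ultimately show ?case by (auto intro!: exI[of _ "\<lambda>x. a * f x powr (a - 1) * f' x"])
qed

lemma smooth_real_mult: "smooth_real f \<Longrightarrow> smooth_real g \<Longrightarrow> smooth_real (\<lambda>x. f x * g x)"
  by (simp add: smooth_real_def Ck_real_mult)

lemma smooth_real_continuous: "smooth_real f \<Longrightarrow> continuous_on UNIV f"
  unfolding smooth_real_def by (metis Ck_real.simps(1))

lemma smooth_real_antiderivative:
  assumes "smooth_real f'" "\<And>x. DERIV f x :> f' x"
  shows "smooth_real f"
  unfolding smooth_real_def
proof
  fix k
  have "Ck_real (Suc k) f" using assms by (auto simp: smooth_real_def)
  then show "Ck_real k f" by (rule Ck_real_Suc_imp_Ck_real)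
qed

lemma Ck_comp: "Ck_real k g \<Longrightarrow> Ck k f \<Longrightarrow> Ck k (\<lambda>x. g (f x))"
proof (induction k arbitrary: f g)
  case 0
  then show ?case by (auto intro: continuous_on_compose2)
next
  case (Suc k)
  then obtain g' where g': "\<And>x. DERIV g x :> g' x" "Ck_real k g'" by auto
  have f: "f differentiable at x" for x using Suc.prems by simp
  have "partial_deriv (\<lambda>x. g (f x)) i = (\<lambda>x. g' (f x) * partial_deriv f i x)" for i
    using partial_deriv_comp[OF f g'(1)] by auto
  moreover have "Ck k (\<lambda>x. g' (f x) * partial_deriv f i x)" for i
    using Suc.prems by (intro Ck_mult Suc.IH[OF g'(2)] Ck_Suc_imp_Ck[OF Suc.prems(2)]) auto
  moreover have "(\<lambda>x. g (f x)) differentiable at x" for x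
    using has_derivative_comp_real[OF f g'(1)] unfolding differentiable_def by blast
  ultimately show ?case by simp
qed

lemma smooth_fun_differentiable: "smooth_fun f \<Longrightarrow> f differentiable at x"
  unfolding smooth_fun_def by (metis Ck.simps(2))

lemma smooth_fun_continuous: "smooth_fun f \<Longrightarrow> continuous_on UNIV f"
  unfolding smooth_fun_def by (metis Ck.simps(1))

lemma smooth_fun_continuous_grad:
  assumes "smooth_fun f"
  shows "continuous_on UNIV (grad f)"
proof -
  have "Ck (Suc 0) f" using assms by (simp only: smooth_fun_def)
  then show ?thesis unfolding grad_def by (intro continuous_on_vec_lambda) simp
qed

lemma eq_0_outside_tsupport:
  assumes "x \<notin> tsupport f"
  shows "f x = 0" "grad f x = 0"
proof -
  have zero: "f y = 0" if "y \<in> - tsupport f" for y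
    using that closure_subset[of "{x. f x \<noteq> 0}"] by (auto simp: tsupport_def)
  with assms show "f x = 0" by simp
  have "open (- tsupport f)" by (simp add: tsupport_def open_Compl)
  then have "(f has_derivative (\<lambda>h. 0)) (at x)"
    using assms zero
    by (intro has_derivative_transform_within_open[OF has_derivative_const[of 0]]) auto
  from partial_deriv_eq[OF this] show "grad f x = 0" by (simp add: grad_def vec_eq_iff)
qed

lemma test_funI:
  assumes "smooth_fun f" "compact K" "K \<subseteq> \<Omega>" "{x. f x \<noteq> 0} \<subseteq> K"
  shows "test_fun \<Omega> f"
proof -
  have "tsupport f \<subseteq> K"
    unfolding tsupport_def using assms(2,4) by (intro closure_minimal compact_imp_closed)
  then show ?thesis
    using assms unfolding test_fun_def
    by (auto simp: tsupport_def compact_eq_bounded_closed bounded_subset)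
qed

lemma test_fun_zero: "test_fun \<Omega> (\<lambda>x. 0)"
  by (rule test_funI[of _ "{}"]) (auto simp: smooth_fun_def Ck_const)

lemma test_fun_add_scaled:
  assumes "test_fun \<Omega> f" "test_fun \<Omega> g"
  shows "test_fun \<Omega> (\<lambda>x. f x + c * g x)"
proof (rule test_funI[of _ "tsupport f \<union> tsupport g"])
  show "{x. f x + c * g x \<noteq> 0} \<subseteq> tsupport f \<union> tsupport g"
    using eq_0_outside_tsupport(1)[of _ f] eq_0_outside_tsupport(1)[of _ g] by fastforce
qed (use assms in \<open>auto simp: test_fun_def smooth_fun_def intro!: Ck_add Ck_mult Ck_const\<close>)

lemma test_fun_diff:
  assumes "test_fun \<Omega> f" "test_fun \<Omega> g"
  shows "test_fun \<Omega> (\<lambda>x. f x - g x)"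
  using test_fun_add_scaled[OF assms, of "- 1"] by simp

lemma test_fun_comp:
  assumes "test_fun \<Omega> f" "smooth_real g" "g 0 = 0"
  shows "test_fun \<Omega> (\<lambda>x. g (f x))"
proof (rule test_funI[of _ "tsupport f"])
  show "{x. g (f x) \<noteq> 0} \<subseteq> tsupport f"
    using eq_0_outside_tsupport(1)[of _ f] assms(3) by fastforce
  show "smooth_fun (\<lambda>x. g (f x))"
    using assms(1,2) by (auto simp: test_fun_def smooth_fun_def smooth_real_def intro: Ck_comp)
qed (use assms(1) in \<open>auto simp: test_fun_def\<close>)

lemma grad_test_fun_add_scaled:
  assumes "test_fun \<Omega> f" "test_fun \<Omega> g"
  shows "grad (\<lambda>x. f x + c * g x) = (\<lambda>x. grad f x + c *\<^sub>R grad g x)"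
  using assms by (auto simp: test_fun_def intro!: grad_add_scaled smooth_fun_differentiable)

lemma grad_test_fun_diff:
  assumes "test_fun \<Omega> f" "test_fun \<Omega> g"
  shows "grad (\<lambda>x. f x - g x) = (\<lambda>x. grad f x - grad g x)"
  using grad_test_fun_add_scaled[OF assms, of "- 1"] by simp

lemma square_integrable_continuous_compact_support:
  fixes f :: "'a::euclidean_space \<Rightarrow> 'b::{real_normed_vector, second_countable_topology}"
  assumes f: "continuous_on UNIV f" and K: "compact K" "\<And>x. x \<notin> K \<Longrightarrow> f x = 0"
  shows "square_integrable lebesgue f"
proof -
  have "integrable lborel (\<lambda>x. indicator K x *\<^sub>R (norm (f x))\<^sup>2)"
    using K(1) by (intro borel_integrable_compact continuous_intros continuous_on_subset[OF f]) auto
  moreover have "(\<lambda>x. indicator K x *\<^sub>R (norm (f x))\<^sup>2) = (\<lambda>x. (norm (f x))\<^sup>2)"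
    using K(2) by (auto simp: indicator_def fun_eq_iff)
  moreover have "f \<in> borel_measurable borel"
    by (rule borel_measurable_continuous_onI[OF f])
  ultimately show ?thesis
    by (simp add: square_integrable_iff_integrable integrable_completion measurable_completion)
qed

lemma test_fun_square_integrable:
  assumes "test_fun \<Omega> f"
  shows "square_integrable lebesgue f" "square_integrable lebesgue (grad f)"
  using assms
  by (auto simp: test_fun_def smooth_fun_continuous smooth_fun_continuous_grad
      eq_0_outside_tsupport intro!: square_integrable_continuous_compact_support[of _ "tsupport f"])

lemma test_fun_measurable:
  assumes "test_fun \<Omega> f"
  shows "f \<in> borel_measurable lebesgue" "grad f \<in> borel_measurable lebesgue"
  using test_fun_square_integrable[OF assms] by (simp_all add: square_integrable_def)

lemma L2_sq_test_fun_restrict: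
  assumes "test_fun \<Omega> f" "\<Omega> \<in> sets lebesgue"
  shows "L2_sq (lebesgue_on \<Omega>) f = L2_sq lebesgue f"
    "L2_sq (lebesgue_on \<Omega>) (grad f) = L2_sq lebesgue (grad f)"
proof -
  have "f x = 0 \<and> grad f x = 0" if "x \<notin> \<Omega>" for x
    using assms(1) that eq_0_outside_tsupport[of x f] by (auto simp: test_fun_def)
  then show "L2_sq (lebesgue_on \<Omega>) f = L2_sq lebesgue f"
    "L2_sq (lebesgue_on \<Omega>) (grad f) = L2_sq lebesgue (grad f)"
    using assms(2) by (auto intro!: L2_sq_restrict_space_eq)
qed

section \<open>The Sobolev space\<close>

lemma H01_iff_L2_tendsto:
  "H01 \<Omega> \<phi> G \<longleftrightarrow> \<phi> \<in> borel_measurable lebesgue \<and> G \<in> borel_measurable lebesgue \<and>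
     (\<exists>\<psi>. (\<forall>k. test_fun \<Omega> (\<psi> k)) \<and> L2_tendsto lebesgue \<psi> \<phi> \<and>
       L2_tendsto lebesgue (\<lambda>k. grad (\<psi> k)) G)"
  by (simp add: H01_def L2_tendsto_def L2_sq_def)

lemma H01_measurable:
  assumes "H01 \<Omega> \<phi> G"
  shows "\<phi> \<in> borel_measurable lebesgue" "G \<in> borel_measurable lebesgue"
  using assms by (simp_all add: H01_def)

lemma H01_test_fun: "test_fun \<Omega> f \<Longrightarrow> H01 \<Omega> f (grad f)"
  unfolding H01_iff_L2_tendsto using test_fun_measurable[of \<Omega> f]
  by (auto simp: L2_tendsto_def L2_sq_def intro!: exI[of _ "\<lambda>k. f"])

lemma H01_approx:
  assumes "H01 \<Omega> \<phi> G"
  obtains \<psi> where "\<And>k. test_fun \<Omega> (\<psi> k)" "L2_tendsto lebesgue \<psi> \<phi>"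
    "L2_tendsto lebesgue (\<lambda>k. grad (\<psi> k)) G"
  using assms unfolding H01_iff_L2_tendsto by blast

lemma H01_square_integrable:
  assumes "H01 \<Omega> \<phi> G"
  shows "square_integrable lebesgue \<phi>" "square_integrable lebesgue G"
  using assms unfolding H01_iff_L2_tendsto
  by (auto intro: L2_tendsto_imp_square_integrable test_fun_square_integrable)

lemma H01_square_integrable_on:
  assumes "H01 \<Omega> \<phi> G" "\<Omega> \<in> sets lebesgue"
  shows "square_integrable (lebesgue_on \<Omega>) \<phi>" "square_integrable (lebesgue_on \<Omega>) G"
  using square_integrable_restrict_space[OF _ assms(2)] H01_square_integrable[OF assms(1)] by auto

lemma H01_complete:
  assumes \<psi>: "\<And>k. test_fun \<Omega> (\<psi> k)"
    and Cauchy: "L2_Cauchy lebesgue \<psi>" "L2_Cauchy lebesgue (\<lambda>k. grad (\<psi> k))"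
  obtains v G where "H01 \<Omega> v G" "L2_tendsto lebesgue (\<lambda>k. grad (\<psi> k)) G"
proof -
  obtain v where v: "v \<in> borel_measurable lebesgue" "L2_tendsto lebesgue \<psi> v"
    using L2_complete[OF test_fun_measurable(1)[OF \<psi>] Cauchy(1)] by blast
  obtain G where G: "G \<in> borel_measurable lebesgue" "L2_tendsto lebesgue (\<lambda>k. grad (\<psi> k)) G"
    using L2_complete[OF test_fun_measurable(2)[OF \<psi>] Cauchy(2)] by blast
  have "H01 \<Omega> v G" unfolding H01_iff_L2_tendsto using \<psi> v G by blast
  then show thesis using G(2) by (rule that)
qed

lemma H01_approx_AE:
  assumes "H01 \<Omega> \<phi> G"
  obtains \<psi> where "\<And>k. test_fun \<Omega> (\<psi> k)" "L2_tendsto lebesgue \<psi> \<phi>"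
    "L2_tendsto lebesgue (\<lambda>k. grad (\<psi> k)) G" "AE x in lebesgue. (\<lambda>k. \<psi> k x) \<longlonglongrightarrow> \<phi> x"
proof -
  obtain \<psi> where \<psi>: "\<And>k. test_fun \<Omega> (\<psi> k)" and lim: "L2_tendsto lebesgue \<psi> \<phi>"
      "L2_tendsto lebesgue (\<lambda>k. grad (\<psi> k)) G"
    using H01_approx[OF assms] by blast
  obtain r :: "nat \<Rightarrow> nat"
    where r: "strict_mono r" "AE x in lebesgue. (\<lambda>k. \<psi> (r k) x) \<longlonglongrightarrow> \<phi> x"
    using L2_tendsto_AE_subseq
      [OF lim(1) test_fun_square_integrable(1)[OF \<psi>] H01_measurable(1)[OF assms]]
    by blast
  show thesis
    by (rule that[OF \<psi> L2_tendsto_subseq[OF lim(1) r(1)] L2_tendsto_subseq[OF lim(2) r(1)] r(2)])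
qed

lemma H01_comp:
  assumes H: "H01 \<Omega> v G" and g: "\<And>t. DERIV g t :> g' t" "g 0 = 0"
    and g': "smooth_real g'" "\<And>t. \<bar>g' t\<bar> \<le> B"
  shows "H01 \<Omega> (\<lambda>x. g (v x)) (\<lambda>x. g' (v x) *\<^sub>R G x)"
proof -
  note g_smooth = smooth_real_antiderivative[OF g'(1) g(1)]
  obtain \<psi> where \<psi>: "\<And>k. test_fun \<Omega> (\<psi> k)" and lim: "L2_tendsto lebesgue \<psi> v"
      "L2_tendsto lebesgue (\<lambda>k. grad (\<psi> k)) G" "AE x in lebesgue. (\<lambda>k. \<psi> k x) \<longlonglongrightarrow> v x"
    using H01_approx_AE[OF H] by blast
  note [measurable] = H01_measurable[OF H] test_fun_measurable[OF \<psi>]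
  have [measurable]: "g \<in> borel_measurable borel" "g' \<in> borel_measurable borel"
    using smooth_real_continuous[OF g_smooth] smooth_real_continuous[OF g'(1)]
    by (auto intro: borel_measurable_continuous_onI)
  have "L2_tendsto lebesgue (\<lambda>k x. g (\<psi> k x)) (\<lambda>x. g (v x))"
  proof (rule L2_tendsto_norm_le[OF lim(1)])
    show "norm (g s - g t) \<le> B * norm (s - t)" for s t
      using field_differentiable_bound[of UNIV g g' B s t] g(1) g'(2)
      by (auto simp: has_field_derivative_at_within)
  qed measurable
  moreover have "L2_tendsto lebesgue (\<lambda>k x. g' (\<psi> k x) *\<^sub>R grad (\<psi> k) x) (\<lambda>x. g' (v x) *\<^sub>R G x)"
  proof (rule L2_tendsto_bounded_scaleR[OF lim(2) H01_square_integrable(2)[OF H], where B = B])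
    show "AE x in lebesgue. (\<lambda>k. g' (\<psi> k x)) \<longlonglongrightarrow> g' (v x)"
      using lim(3)
    proof eventually_elim
      case (elim x)
      have "isCont g' (v x)"
        using smooth_real_continuous[OF g'(1)] by (simp add: continuous_on_eq_continuous_at)
      from this elim show ?case by (rule isCont_tendsto_compose)
    qed
  qed (use g'(2) in \<open>simp_all add: measurable_compose\<close>)
  moreover have "grad (\<lambda>x. g (\<psi> k x)) = (\<lambda>x. g' (\<psi> k x) *\<^sub>R grad (\<psi> k) x)" for k
    using \<psi>[of k] g(1)
    by (auto simp: test_fun_def intro!: grad_comp smooth_fun_differentiable)
  moreover have "test_fun \<Omega> (\<lambda>x. g (\<psi> k x))" for k
    by (rule test_fun_comp[OF \<psi> g_smooth g(2)])
  ultimately show ?thesis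
    unfolding H01_iff_L2_tendsto by (intro conjI exI[of _ "\<lambda>k x. g (\<psi> k x)"]) auto
qed

section \<open>Minimizing sequences of quadratic functionals\<close>

locale quadratic_functional =
  fixes V :: "('a \<Rightarrow> real) set"
    and a :: "('a \<Rightarrow> real) \<Rightarrow> ('a \<Rightarrow> real) \<Rightarrow> real"
    and L :: "('a \<Rightarrow> real) \<Rightarrow> real"
    and C :: real
  assumes nonempty: "V \<noteq> {}"
    and add_scaled_closed: "f \<in> V \<Longrightarrow> g \<in> V \<Longrightarrow> (\<lambda>x. f x + c * g x) \<in> V"
    and form_add_scaled: "f \<in> V \<Longrightarrow> g \<in> V \<Longrightarrow> h \<in> V \<Longrightarrow>
          a (\<lambda>x. f x + c * g x) h = a f h + c * a g h"
    and form_sym: "f \<in> V \<Longrightarrow> g \<in> V \<Longrightarrow> a f g = a g f"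
    and form_nonneg: "f \<in> V \<Longrightarrow> 0 \<le> a f f"
    and functional_add_scaled: "f \<in> V \<Longrightarrow> g \<in> V \<Longrightarrow> L (\<lambda>x. f x + c * g x) = L f + c * L g"
    and functional_sq_le: "f \<in> V \<Longrightarrow> (L f)\<^sup>2 \<le> C * a f f"
    and bound_nonneg: "0 \<le> C"
begin

definition energy :: "('a \<Rightarrow> real) \<Rightarrow> real" where
  "energy f = a f f / 2 - L f"

definition min_energy :: real where
  "min_energy = Inf (energy ` V)"

lemma energy_add_scaled:
  assumes f: "f \<in> V" and g: "g \<in> V"
  shows "energy (\<lambda>x. f x + c * g x) = a g g / 2 * c\<^sup>2 + (a f g - L g) * c + energy f"
proof -
  let ?h = "\<lambda>x. f x + c * g x"
  have h: "?h \<in> V" by (rule add_scaled_closed[OF f g])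
  have "a ?h ?h = a f ?h + c * a g ?h" by (rule form_add_scaled[OF f g h])
  also have "\<dots> = (a f f + c * a g f) + c * (a f g + c * a g g)"
    using f g by (simp add: form_sym[OF _ h] form_add_scaled)
  finally show ?thesis
    using f g
    by (simp add: energy_def functional_add_scaled form_sym[OF g f] field_simps power2_eq_square)
qed

lemma energy_ge:
  assumes "f \<in> V"
  shows "- (C / 2) \<le> energy f"
proof -
  have "(L f)\<^sup>2 \<le> C * a f f" by (rule functional_sq_le[OF assms])
  also have "\<dots> \<le> ((C + a f f) / 2)\<^sup>2"
    using zero_le_power2[of "C - a f f"] by (simp add: power2_eq_square field_simps)
  finally have "L f \<le> (C + a f f) / 2"
    by (rule power2_le_imp_le) (use form_nonneg[OF assms] bound_nonneg in simp)
  then show ?thesis by (simp add: energy_def field_simps)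
qed

lemma min_energy_le: "f \<in> V \<Longrightarrow> min_energy \<le> energy f"
  unfolding min_energy_def using energy_ge by (intro cInf_lower bdd_belowI2) auto

lemma form_diff_le:
  assumes f: "f \<in> V" and g: "g \<in> V"
  shows "a (\<lambda>x. f x - g x) (\<lambda>x. f x - g x)
    \<le> 4 * ((energy f - min_energy) + (energy g - min_energy))"
proof -
  define d where "d = (\<lambda>x. f x - g x)"
  have d: "d \<in> V" unfolding d_def using add_scaled_closed[OF f g, of "- 1"] by simp
  have "(\<lambda>x. g x + 1 * d x) = f" by (auto simp: d_def)
  with energy_add_scaled[OF g d, of 1] have "energy f = a d d / 2 + (a g d - L d) + energy g"
    by simp
  moreover have "min_energy \<le> a d d / 8 + (a g d - L d) / 2 + energy g"
    using min_energy_le[OF add_scaled_closed[OF g d, of "1/2"]] energy_add_scaled[OF g d, of "1/2"]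
    by (simp add: power2_eq_square)
  ultimately show ?thesis unfolding d_def[symmetric] by argo
qed

lemma form_minus_functional_sq_le:
  assumes f: "f \<in> V" and g: "g \<in> V"
  shows "(a f g - L g)\<^sup>2 \<le> 2 * a g g * (energy f - min_energy)"
proof -
  have "0 \<le> a g g / 2 * t\<^sup>2 + (a f g - L g) * t + (energy f - min_energy)" for t
    using min_energy_le[OF add_scaled_closed[OF f g, of t]] energy_add_scaled[OF f g, of t] by simp
  then have "(a f g - L g)\<^sup>2 \<le> 4 * (a g g / 2) * (energy f - min_energy)"
    by (rule nonneg_quadratic_imp_discriminant_nonpos) (simp add: form_nonneg[OF g])
  then show ?thesis by simp
qed

lemma minimizing_sequence_exists:
  "\<exists>\<psi>. (\<forall>k::nat. \<psi> k \<in> V) \<and> (\<lambda>k. energy (\<psi> k)) \<longlonglongrightarrow> min_energy"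
proof -
  have "\<exists>f\<in>V. energy f < min_energy + 1 / real (Suc k)" for k
    using cInf_lessD[of "energy ` V" "min_energy + 1 / real (Suc k)"] nonempty
    by (auto simp: min_energy_def)
  then obtain \<psi> where \<psi>: "\<And>k. \<psi> k \<in> V" "\<And>k. energy (\<psi> k) < min_energy + 1 / real (Suc k)"
    by metis
  have "(\<lambda>k. energy (\<psi> k)) \<longlonglongrightarrow> min_energy"
  proof (rule tendsto_sandwich[OF _ _ tendsto_const])
    show "(\<lambda>k. min_energy + 1 / real (Suc k)) \<longlonglongrightarrow> min_energy"
      using LIMSEQ_inverse_real_of_nat_add by (simp add: inverse_eq_divide)
    show "\<forall>\<^sub>F k in sequentially. energy (\<psi> k) \<le> min_energy + 1 / real (Suc k)"
      by (intro always_eventually allI less_imp_le \<psi>(2))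
  qed (use \<psi>(1) min_energy_le in auto)
  with \<psi>(1) show ?thesis by blast
qed

lemma minimizing_sequence_Cauchy:
  assumes \<psi>: "\<And>k. \<psi> k \<in> V" and lim: "(\<lambda>k. energy (\<psi> k)) \<longlonglongrightarrow> min_energy" and "0 < e"
  shows "\<exists>N. \<forall>k\<ge>N. \<forall>l\<ge>N. a (\<lambda>x. \<psi> k x - \<psi> l x) (\<lambda>x. \<psi> k x - \<psi> l x) \<le> e"
proof -
  have "\<forall>\<^sub>F k in sequentially. energy (\<psi> k) < min_energy + e / 8"
    using \<open>0 < e\<close> by (intro order_tendstoD(2)[OF lim]) simp
  then obtain N where N: "\<And>k. N \<le> k \<Longrightarrow> energy (\<psi> k) < min_energy + e / 8"
    by (auto simp: eventually_sequentially)
  have "a (\<lambda>x. \<psi> k x - \<psi> l x) (\<lambda>x. \<psi> k x - \<psi> l x) \<le> e" if "N \<le> k" "N \<le> l" for k l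
    using form_diff_le[OF \<psi>[of k] \<psi>[of l]] N[OF that(1)] N[OF that(2)] by argo
  then show ?thesis by blast
qed

lemma minimizing_sequence_form_tendsto:
  assumes \<psi>: "\<And>k. \<psi> k \<in> V" and lim: "(\<lambda>k. energy (\<psi> k)) \<longlonglongrightarrow> min_energy" and g: "g \<in> V"
  shows "(\<lambda>k. a (\<psi> k) g) \<longlonglongrightarrow> L g"
proof -
  have "(\<lambda>k. (a (\<psi> k) g - L g)\<^sup>2) \<longlonglongrightarrow> 0"
  proof (rule tendsto_sandwich[OF _ _ tendsto_const])
    show "(\<lambda>k. 2 * a g g * (energy (\<psi> k) - min_energy)) \<longlonglongrightarrow> 0"
      using lim by (intro tendsto_mult_right_zero) (simp add: LIM_zero_iff)
  qed (use form_minus_functional_sq_le[OF \<psi> g] in auto)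
  then show ?thesis by (simp add: LIM_zero_iff)
qed

end

section \<open>Existence of the torsion function\<close>

lemma set_integral_eq_lebesgue_on:
  fixes f :: "real^'m \<Rightarrow> real"
  shows "A \<in> sets lebesgue \<Longrightarrow> (\<integral>x\<in>A. f x \<partial>lebesgue) = (\<integral>x. f x \<partial>lebesgue_on A)"
  by (simp add: set_lebesgue_integral_def integral_restrict_space)

locale poincare_domain =
  fixes \<Omega> :: "(real^'m) set" and c :: real
  assumes domain_lmeasurable: "\<Omega> \<in> lmeasurable"
    and c_pos: "0 < c"
    and poincare: "H01 \<Omega> \<phi> G \<Longrightarrow>
          c * (\<integral>x. (\<phi> x)\<^sup>2 \<partial>lebesgue_on \<Omega>) \<le> (\<integral>x. (norm (G x))\<^sup>2 \<partial>lebesgue_on \<Omega>)"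
begin

lemma domain_sets: "\<Omega> \<in> sets lebesgue"
  using domain_lmeasurable by (rule fmeasurableD)

sublocale finite_measure "lebesgue_on \<Omega>"
  using domain_lmeasurable by (rule finite_measure_lebesgue_on)

lemma measure_domain: "measure (lebesgue_on \<Omega>) \<Omega> = measure lebesgue \<Omega>"
  using domain_sets by (simp add: measure_restrict_space)

definition dirichlet_form :: "(real^'m \<Rightarrow> real) \<Rightarrow> (real^'m \<Rightarrow> real) \<Rightarrow> real" where
  "dirichlet_form f g = (\<integral>x. grad f x \<bullet> grad g x \<partial>lebesgue_on \<Omega>)"

lemma test_fun_square_integrable_on:
  assumes "test_fun \<Omega> f"
  shows "square_integrable (lebesgue_on \<Omega>) f" "square_integrable (lebesgue_on \<Omega>) (grad f)"
  using H01_square_integrable_on[OF H01_test_fun[OF assms] domain_sets] .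

lemma dirichlet_form_self: "dirichlet_form f f = (\<integral>x. (norm (grad f x))\<^sup>2 \<partial>lebesgue_on \<Omega>)"
  by (simp add: dirichlet_form_def power2_norm_eq_inner)

lemma poincare_test_fun:
  "test_fun \<Omega> f \<Longrightarrow> c * (\<integral>x. (f x)\<^sup>2 \<partial>lebesgue_on \<Omega>) \<le> dirichlet_form f f"
  using poincare[OF H01_test_fun] by (simp add: dirichlet_form_self)

sublocale quadratic_functional "{f. test_fun \<Omega> f}" dirichlet_form
  "\<lambda>f. \<integral>x. f x \<partial>lebesgue_on \<Omega>" "measure lebesgue \<Omega> / c"
proof unfold_locales
  note square_integrable_on = test_fun_square_integrable_on
  note integrable_inner = square_integrable_imp_integrable_inner
  show "{f. test_fun \<Omega> f} \<noteq> {}" using test_fun_zero by blast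
  show "0 \<le> measure lebesgue \<Omega> / c" using c_pos by simp
  fix f :: "real^'m \<Rightarrow> real" assume "f \<in> {f. test_fun \<Omega> f}"
  then have f: "test_fun \<Omega> f" by simp
  show "0 \<le> dirichlet_form f f" by (simp add: dirichlet_form_self)
  have "(\<integral>x. f x \<partial>lebesgue_on \<Omega>)\<^sup>2 \<le> measure lebesgue \<Omega> * (\<integral>x. (f x)\<^sup>2 \<partial>lebesgue_on \<Omega>)"
    using integral_sq_le[OF square_integrable_on(1)[OF f]] by (simp add: measure_domain)
  also have "\<dots> \<le> measure lebesgue \<Omega> * (dirichlet_form f f / c)"
    using poincare_test_fun[OF f] c_pos by (intro mult_left_mono) (auto simp: field_simps)
  finally show "(\<integral>x. f x \<partial>lebesgue_on \<Omega>)\<^sup>2 \<le> measure lebesgue \<Omega> / c * dirichlet_form f f" by simp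
  fix g :: "real^'m \<Rightarrow> real" assume "g \<in> {f. test_fun \<Omega> f}"
  then have g: "test_fun \<Omega> g" by simp
  show "(\<lambda>x. f x + t * g x) \<in> {f. test_fun \<Omega> f}" for t
    using test_fun_add_scaled[OF f g] by simp
  show "dirichlet_form f g = dirichlet_form g f" by (simp add: dirichlet_form_def inner_commute)
  have "integrable (lebesgue_on \<Omega>) f" "integrable (lebesgue_on \<Omega>) g"
    using f g by (auto intro: square_integrable_imp_integrable square_integrable_on(1))
  then show "(\<integral>x. f x + t * g x \<partial>lebesgue_on \<Omega>)
      = (\<integral>x. f x \<partial>lebesgue_on \<Omega>) + t * (\<integral>x. g x \<partial>lebesgue_on \<Omega>)" for t by simp
  fix h :: "real^'m \<Rightarrow> real" assume "h \<in> {f. test_fun \<Omega> f}"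
  then have h: "test_fun \<Omega> h" by simp
  show "dirichlet_form (\<lambda>x. f x + t * g x) h = dirichlet_form f h + t * dirichlet_form g h" for t
    using integrable_inner[OF square_integrable_on(2)[OF f] square_integrable_on(2)[OF h]]
      integrable_inner[OF square_integrable_on(2)[OF g] square_integrable_on(2)[OF h]]
    by (simp add: dirichlet_form_def grad_test_fun_add_scaled[OF f g] inner_add_left)
qed

lemma L2_sq_grad_diff_eq:
  assumes f: "test_fun \<Omega> f" and g: "test_fun \<Omega> g"
  shows "L2_sq lebesgue (\<lambda>x. grad f x - grad g x)
    = ennreal (dirichlet_form (\<lambda>x. f x - g x) (\<lambda>x. f x - g x))"
proof -
  have diff: "test_fun \<Omega> (\<lambda>x. f x - g x)" by (rule test_fun_diff[OF f g])
  have "L2_sq lebesgue (\<lambda>x. grad f x - grad g x) = L2_sq lebesgue (grad (\<lambda>x. f x - g x))"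
    by (simp add: grad_test_fun_diff[OF f g])
  also have "\<dots> = L2_sq (lebesgue_on \<Omega>) (grad (\<lambda>x. f x - g x))"
    by (rule L2_sq_test_fun_restrict(2)[OF diff domain_sets, symmetric])
  also have "\<dots> = ennreal (dirichlet_form (\<lambda>x. f x - g x) (\<lambda>x. f x - g x))"
    unfolding dirichlet_form_self
    by (rule L2_sq_eq_integral[OF test_fun_square_integrable_on(2)[OF diff]])
  finally show ?thesis .
qed

lemma L2_sq_diff_le:
  assumes f: "test_fun \<Omega> f" and g: "test_fun \<Omega> g"
  shows "L2_sq lebesgue (\<lambda>x. f x - g x)
    \<le> ennreal (dirichlet_form (\<lambda>x. f x - g x) (\<lambda>x. f x - g x) / c)"
proof -
  have diff: "test_fun \<Omega> (\<lambda>x. f x - g x)" by (rule test_fun_diff[OF f g])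
  have "L2_sq lebesgue (\<lambda>x. f x - g x) = L2_sq (lebesgue_on \<Omega>) (\<lambda>x. f x - g x)"
    by (rule L2_sq_test_fun_restrict(1)[OF diff domain_sets, symmetric])
  also have "\<dots> = ennreal (\<integral>x. (f x - g x)\<^sup>2 \<partial>lebesgue_on \<Omega>)"
    using L2_sq_eq_integral[OF test_fun_square_integrable_on(1)[OF diff]] by simp
  also have "\<dots> \<le> ennreal (dirichlet_form (\<lambda>x. f x - g x) (\<lambda>x. f x - g x) / c)"
    using poincare_test_fun[OF diff] c_pos by (intro ennreal_leI) (simp add: field_simps)
  finally show ?thesis .
qed

lemma minimizing_sequence_L2_Cauchy:
  assumes \<psi>: "\<And>k. test_fun \<Omega> (\<psi> k)" and lim: "(\<lambda>k. energy (\<psi> k)) \<longlonglongrightarrow> min_energy"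
  shows "L2_Cauchy lebesgue \<psi>" "L2_Cauchy lebesgue (\<lambda>k. grad (\<psi> k))"
proof -
  let ?a = "\<lambda>k l. dirichlet_form (\<lambda>x. \<psi> k x - \<psi> l x) (\<lambda>x. \<psi> k x - \<psi> l x)"
  have Cauchy: "\<exists>N. \<forall>k\<ge>N. \<forall>l\<ge>N. ?a k l \<le> e" if "0 < e" for e
    by (rule minimizing_sequence_Cauchy[OF _ lim that]) (simp add: \<psi>)
  show "L2_Cauchy lebesgue (\<lambda>k. grad (\<psi> k))"
    unfolding L2_Cauchy_def L2_sq_grad_diff_eq[OF \<psi> \<psi>] using Cauchy by (meson ennreal_leI)
  show "L2_Cauchy lebesgue \<psi>"
    unfolding L2_Cauchy_def
  proof (intro allI impI)
    fix e :: real assume "0 < e"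
    with c_pos obtain N where N: "\<And>k l. N \<le> k \<Longrightarrow> N \<le> l \<Longrightarrow> ?a k l \<le> c * e"
      using Cauchy[of "c * e"] by auto
    have "L2_sq lebesgue (\<lambda>x. \<psi> k x - \<psi> l x) \<le> ennreal e" if "N \<le> k" "N \<le> l" for k l
      using N[OF that] c_pos
      by (intro order_trans[OF L2_sq_diff_le[OF \<psi> \<psi>]] ennreal_leI) (simp add: field_simps)
    then show "\<exists>N. \<forall>k\<ge>N. \<forall>l\<ge>N. L2_sq lebesgue (\<lambda>x. \<psi> k x - \<psi> l x) \<le> ennreal e" by blast
  qed
qed

lemma weak_torsion_equation_test_fun_imp_H01:
  assumes G: "square_integrable (lebesgue_on \<Omega>) G"
    and test: "\<And>\<eta>. test_fun \<Omega> \<eta> \<Longrightarrow>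
      (\<integral>x. G x \<bullet> grad \<eta> x \<partial>lebesgue_on \<Omega>) = (\<integral>x. \<eta> x \<partial>lebesgue_on \<Omega>)"
    and \<phi>: "H01 \<Omega> \<phi> K"
  shows "(\<integral>x. G x \<bullet> K x \<partial>lebesgue_on \<Omega>) = (\<integral>x. \<phi> x \<partial>lebesgue_on \<Omega>)"
proof -
  obtain \<eta> where \<eta>: "\<And>k. test_fun \<Omega> (\<eta> k)" and lim: "L2_tendsto lebesgue \<eta> \<phi>"
      "L2_tendsto lebesgue (\<lambda>k. grad (\<eta> k)) K"
    using H01_approx[OF \<phi>] by blast
  note lim_on = lim[THEN L2_tendsto_restrict_space[OF _ domain_sets]]
  note meas = H01_square_integrable_on[OF \<phi> domain_sets, THEN square_integrable_measurable]
  have "(\<lambda>k. \<integral>x. \<eta> k x \<partial>lebesgue_on \<Omega>) \<longlonglongrightarrow> (\<integral>x. G x \<bullet> K x \<partial>lebesgue_on \<Omega>)"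
    using L2_tendsto_inner[OF lim_on(2) test_fun_square_integrable_on(2)[OF \<eta>] meas(2) G]
    by (simp add: test[OF \<eta>])
  moreover have "(\<lambda>k. \<integral>x. \<eta> k x \<partial>lebesgue_on \<Omega>) \<longlonglongrightarrow> (\<integral>x. \<phi> x \<partial>lebesgue_on \<Omega>)"
    using L2_tendsto_inner[OF lim_on(1) test_fun_square_integrable_on(1)[OF \<eta>] meas(1)
        square_integrable_const[of 1]]
    by simp
  ultimately show ?thesis by (rule LIMSEQ_unique)
qed

theorem torsion_exists: "\<exists>v. is_torsion \<Omega> v"
proof -
  obtain \<psi> where \<psi>: "\<And>k. test_fun \<Omega> (\<psi> k)" and lim: "(\<lambda>k. energy (\<psi> k)) \<longlonglongrightarrow> min_energy"
    using minimizing_sequence_exists by auto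
  obtain v G where H: "H01 \<Omega> v G" and G: "L2_tendsto lebesgue (\<lambda>k. grad (\<psi> k)) G"
    by (rule H01_complete[OF \<psi> minimizing_sequence_L2_Cauchy[OF \<psi> lim]])
  note G_square = H01_square_integrable_on(2)[OF H domain_sets]
  have "(\<integral>x. G x \<bullet> grad \<eta> x \<partial>lebesgue_on \<Omega>) = (\<integral>x. \<eta> x \<partial>lebesgue_on \<Omega>)" if \<eta>: "test_fun \<Omega> \<eta>" for \<eta>
  proof (rule LIMSEQ_unique)
    show "(\<lambda>k. dirichlet_form (\<psi> k) \<eta>) \<longlonglongrightarrow> (\<integral>x. \<eta> x \<partial>lebesgue_on \<Omega>)"
      by (rule minimizing_sequence_form_tendsto[OF _ lim]) (simp_all add: \<psi> \<eta>)
    show "(\<lambda>k. dirichlet_form (\<psi> k) \<eta>) \<longlonglongrightarrow> (\<integral>x. G x \<bullet> grad \<eta> x \<partial>lebesgue_on \<Omega>)"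
      using L2_tendsto_inner[OF L2_tendsto_restrict_space[OF G domain_sets]
          test_fun_square_integrable_on(2)[OF \<psi>] square_integrable_measurable[OF G_square]
          test_fun_square_integrable_on(2)[OF \<eta>]]
      by (simp add: dirichlet_form_def inner_commute)
  qed
  from H weak_torsion_equation_test_fun_imp_H01[OF G_square this] show ?thesis
    unfolding is_torsion_def set_integral_eq_lebesgue_on[OF domain_sets] by blast
qed

end

section \<open>Regularized powers\<close>

lemma antiderivative_exists:
  fixes f :: "real \<Rightarrow> real"
  assumes "continuous_on UNIV f"
  obtains F where "\<And>x. DERIV F x :> f x" "F 0 = 0"
proof -
  have "\<exists>F. \<forall>x::real. - \<infinity> < ereal x \<longrightarrow> ereal x < \<infinity> \<longrightarrow> (F has_vector_derivative f x) (at x)"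
    using assms by (intro einterval_antiderivative) (auto simp: continuous_on_eq_continuous_at)
  then obtain F where "\<And>x. DERIV F x :> f x"
    by (auto simp: has_real_derivative_iff_has_vector_derivative)
  then show thesis
    by (intro that[of "\<lambda>x. F x - F 0"]) (auto intro!: derivative_eq_intros)
qed

text \<open>For \<open>0 < e \<le> 1\<close> this is smooth, positive and bounded, and it tends to \<open>\<bar>t\<bar>\<close> as \<open>e \<rightarrow> 0\<close>:
  the term \<open>e\<^sup>2\<close> removes the singularity at 0, the denominator the growth at infinity.\<close>
definition smooth_abs :: "real \<Rightarrow> real \<Rightarrow> real" where
  "smooth_abs e t = sqrt ((e\<^sup>2 + t\<^sup>2) / (1 + e * t\<^sup>2))"

lemma smooth_abs_pos: "0 < e \<Longrightarrow> 0 < smooth_abs e t"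
  by (simp add: smooth_abs_def add_pos_nonneg)

lemma smooth_abs_minus: "smooth_abs e (- t) = smooth_abs e t"
  by (simp add: smooth_abs_def)

lemma smooth_abs_le_abs_add:
  assumes "0 < e"
  shows "smooth_abs e t \<le> \<bar>t\<bar> + e"
  unfolding smooth_abs_def
proof (rule real_le_lsqrt)
  have "(e\<^sup>2 + t\<^sup>2) / (1 + e * t\<^sup>2) \<le> (e\<^sup>2 + t\<^sup>2) / 1"
    using assms by (intro divide_left_mono) (auto intro: add_pos_nonneg)
  also have "\<dots> \<le> (\<bar>t\<bar> + e)\<^sup>2" using assms by (simp add: power2_sum)
  finally show "(e\<^sup>2 + t\<^sup>2) / (1 + e * t\<^sup>2) \<le> (\<bar>t\<bar> + e)\<^sup>2" .
qed (use assms in auto)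

lemma smooth_abs_le_sqrt_inverse:
  assumes "0 < e" "e \<le> 1"
  shows "smooth_abs e t \<le> sqrt (1 / e)"
proof -
  have "0 < 1 + e * t\<^sup>2" using assms by (simp add: add_pos_nonneg)
  moreover have "e ^ 3 \<le> 1" using assms by (simp add: power_le_one)
  ultimately show ?thesis
    unfolding smooth_abs_def using assms(1)
    by (simp add: field_simps power2_eq_square power3_eq_cube)
qed

lemma abs_divide_sqrt_le_smooth_abs:
  assumes "0 < e" "\<bar>s\<bar> \<le> \<bar>t\<bar>"
  shows "\<bar>s\<bar> / sqrt (1 + e * t\<^sup>2) \<le> smooth_abs e s"
proof -
  have "s\<^sup>2 \<le> t\<^sup>2" using assms(2) by (simp add: abs_le_square_iff)
  then have "s\<^sup>2 / (1 + e * t\<^sup>2) \<le> (e\<^sup>2 + s\<^sup>2) / (1 + e * s\<^sup>2)"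
    using assms(1) by (intro frac_le) (auto intro: add_pos_nonneg)
  from real_sqrt_le_mono[OF this] show ?thesis
    by (simp add: smooth_abs_def real_sqrt_divide)
qed

lemma smooth_real_smooth_abs_powr:
  assumes "0 < e"
  shows "smooth_real (\<lambda>t. smooth_abs e t powr a)"
proof -
  have pos: "0 < e\<^sup>2 + t * t" "0 < 1 + e * (t * t)" for t
    using assms by (simp_all add: add_pos_nonneg)
  have "smooth_abs e t powr a = (e\<^sup>2 + t * t) powr (a / 2) * (1 + e * (t * t)) powr (- a / 2)" for t
    using pos[of t] powr_half_sqrt[of "(e\<^sup>2 + t * t) / (1 + e * (t * t))"]
    by (simp add: smooth_abs_def power2_eq_square[of t] powr_powr powr_divide powr_minus_divide
        flip: powr_half_sqrt)
  then show ?thesis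
    unfolding smooth_real_def
    by (auto intro!: Ck_real_mult Ck_real_powr Ck_real_add Ck_real_const Ck_real_ident pos)
qed

text \<open>As \<open>e \<rightarrow> 0\<close> this tends to \<open>(p/2) \<bar>t\<bar>^(p/2 - 1)\<close>, whose antiderivative squares to \<open>\<bar>t\<bar>^p\<close>.\<close>
definition moment_weight :: "real \<Rightarrow> real \<Rightarrow> real \<Rightarrow> real" where
  "moment_weight p e t = p / 2 * smooth_abs e t powr ((p - 2) / 2)"

lemma smooth_real_moment_weight: "0 < e \<Longrightarrow> smooth_real (moment_weight p e)"
  unfolding moment_weight_def
  by (intro smooth_real_mult smooth_real_smooth_abs_powr) (simp add: smooth_real_def Ck_real_const)

lemma moment_weight_bounded:
  assumes "0 < e" "e \<le> 1" "2 \<le> p"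
  shows "\<bar>moment_weight p e t\<bar> \<le> p / 2 * sqrt (1 / e) powr ((p - 2) / 2)"
  unfolding moment_weight_def abs_mult
  using assms smooth_abs_pos[of e t] smooth_abs_le_sqrt_inverse[of e t]
  by (auto intro!: mult_left_mono powr_mono2)

lemma moment_weight_sq_le:
  assumes "0 < e" "2 \<le> p"
  shows "(moment_weight p e t)\<^sup>2 \<le> p\<^sup>2 / 4 * (\<bar>t\<bar> + e) powr (p - 2)"
proof -
  have "(moment_weight p e t)\<^sup>2 = p\<^sup>2 / 4 * smooth_abs e t powr (p - 2)"
    by (simp add: moment_weight_def power2_eq_square flip: powr_add)
  also have "\<dots> \<le> p\<^sup>2 / 4 * (\<bar>t\<bar> + e) powr (p - 2)"
    using assms smooth_abs_pos[of e t] smooth_abs_le_abs_add[of e t]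
    by (intro mult_left_mono powr_mono2) auto
  finally show ?thesis .
qed

lemma moment_weight_ge:
  assumes "0 < e" "2 \<le> p" "\<bar>s\<bar> \<le> \<bar>t\<bar>"
  shows "p / 2 * \<bar>s\<bar> powr ((p - 2) / 2) / sqrt (1 + e * t\<^sup>2) powr ((p - 2) / 2)
    \<le> moment_weight p e s"
proof -
  have "p / 2 * (\<bar>s\<bar> / sqrt (1 + e * t\<^sup>2)) powr ((p - 2) / 2) \<le> moment_weight p e s"
    unfolding moment_weight_def using assms abs_divide_sqrt_le_smooth_abs[OF assms(1,3)]
    by (intro mult_left_mono powr_mono2) auto
  then show ?thesis using assms(1) by (simp add: powr_divide)
qed

lemma moment_weight_antiderivative_ge_of_nonneg:
  assumes e: "0 < e" and p: "2 \<le> p" and g: "\<And>t. DERIV g t :> moment_weight p e t" "g 0 = 0"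
    and t: "0 \<le> t"
  shows "t powr (p / 2) / sqrt (1 + e * t\<^sup>2) powr ((p - 2) / 2) \<le> g t"
proof -
  define K where "K = sqrt (1 + e * t\<^sup>2) powr ((p - 2) / 2)"
  have "g 0 - 0 powr (p / 2) / K \<le> g t - t powr (p / 2) / K"
  proof (rule DERIV_nonneg_imp_increasing_open[OF t])
    fix s assume s: "0 < s" "s < t"
    have "DERIV (\<lambda>s. g s - s powr (p / 2) / K) s :>
        moment_weight p e s - p / 2 * s powr (p / 2 - 1) / K"
      by (intro DERIV_diff g(1) DERIV_cdivide has_real_derivative_powr s(1))
    moreover have "p / 2 * s powr (p / 2 - 1) / K \<le> moment_weight p e s"
      using moment_weight_ge[OF e p, of s t] s by (simp add: K_def diff_divide_distrib)
    ultimately show "\<exists>y. DERIV (\<lambda>s. g s - s powr (p / 2) / K) s :> y \<and> 0 \<le> y"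
      by (metis diff_ge_0_iff_ge)
  next
    have "continuous_on {0..t} g"
      using g(1) by (auto intro!: continuous_at_imp_continuous_on DERIV_isCont)
    moreover have "continuous_on {0..t} (\<lambda>s. s powr (p / 2))"
      using p by (intro continuous_on_powr' continuous_intros) auto
    moreover have "0 < K" using e by (simp add: K_def add_pos_nonneg less_imp_neq[symmetric])
    ultimately show "continuous_on {0..t} (\<lambda>s. g s - s powr (p / 2) / K)"
      by (intro continuous_on_diff continuous_on_divide continuous_on_const) auto
  qed
  then show ?thesis using g(2) by (simp add: K_def)
qed

lemma moment_weight_antiderivative_sq_ge:
  assumes e: "0 < e" and p: "2 \<le> p" and g: "\<And>t. DERIV g t :> moment_weight p e t" "g 0 = 0"
  shows "\<bar>t\<bar> powr p / sqrt (1 + e * t\<^sup>2) powr (p - 2) \<le> (g t)\<^sup>2"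
proof -
  let ?K = "sqrt (1 + e * t\<^sup>2) powr ((p - 2) / 2)"
  have "\<bar>t\<bar> powr (p / 2) / ?K \<le> \<bar>g t\<bar>"
  proof (cases "0 \<le> t")
    case True
    then show ?thesis using moment_weight_antiderivative_ge_of_nonneg[OF e p g True] by simp
  next
    case False
    have "DERIV (\<lambda>s. - g (- s)) s :> moment_weight p e s" for s
      by (auto intro!: derivative_eq_intros DERIV_chain2[OF g(1)]
          simp: moment_weight_def smooth_abs_minus)
    from moment_weight_antiderivative_ge_of_nonneg[OF e p this, of "- t"]
    show ?thesis using False g(2) by simp
  qed
  then have "(\<bar>t\<bar> powr (p / 2) / ?K)\<^sup>2 \<le> \<bar>g t\<bar>\<^sup>2" by (intro power_mono) auto
  then show ?thesis by (simp add: power2_eq_square flip: powr_add)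
qed

lemma moment_weight_sq_antiderivative_le:
  assumes e: "0 < e" and p: "2 \<le> p" and h: "\<And>t. DERIV h t :> (moment_weight p e t)\<^sup>2" "h 0 = 0"
  shows "h t \<le> p\<^sup>2 / (4 * (p - 1)) * (\<bar>t\<bar> + e) powr (p - 1)"
proof (cases "0 \<le> t")
  case True
  define C where "C = p\<^sup>2 / (4 * (p - 1))"
  have C: "C * (p - 1) = p\<^sup>2 / 4" "0 \<le> C" using p by (simp_all add: C_def field_simps)
  have "C * (0 + e) powr (p - 1) - h 0 \<le> C * (t + e) powr (p - 1) - h t"
  proof (rule DERIV_nonneg_imp_nondecreasing[OF True])
    fix s assume s: "0 \<le> s" "s \<le> t"
    have "DERIV (\<lambda>s. C * (s + e) powr (p - 1) - h s) s :>
        C * (p - 1) * (s + e) powr (p - 2) - (moment_weight p e s)\<^sup>2"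
      using s e by (auto intro!: derivative_eq_intros h(1))
    moreover have "(moment_weight p e s)\<^sup>2 \<le> C * (p - 1) * (s + e) powr (p - 2)"
      using moment_weight_sq_le[OF e p, of s] s by (simp add: C)
    ultimately show "\<exists>y. DERIV (\<lambda>s. C * (s + e) powr (p - 1) - h s) s :> y \<and> 0 \<le> y"
      by (metis diff_ge_0_iff_ge)
  qed
  moreover have "0 \<le> C * (0 + e) powr (p - 1)" using C(2) by simp
  ultimately show ?thesis using True h(2) by (simp add: C_def)
next
  case False
  have "\<exists>y. DERIV h x :> y \<and> 0 \<le> y" for x using h(1)[of x] zero_le_power2 by blast
  with False have "h t \<le> h 0" by (intro DERIV_nonneg_imp_nondecreasing[of t 0 h]) auto
  also have "\<dots> \<le> p\<^sup>2 / (4 * (p - 1)) * (\<bar>t\<bar> + e) powr (p - 1)" using h(2) p by simp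
  finally show ?thesis .
qed

section \<open>Moments of the torsion function\<close>

lemma ennreal_integral_le_nn_integral:
  fixes f :: "'a \<Rightarrow> real"
  shows "ennreal (\<integral>x. f x \<partial>M) \<le> (\<integral>\<^sup>+x. ennreal (f x) \<partial>M)"
proof (cases "\<integral>\<^sup>+x. ennreal (f x) \<partial>M")
  case (real r)
  then show ?thesis using integral_real_bounded[of r M f] by (simp add: ennreal_leI)
qed simp

lemma add_powr_le:
  fixes a b q :: real
  assumes "0 \<le> a" "0 \<le> b" "b \<le> 1" "0 \<le> q"
  shows "(a + b) powr q \<le> 2 powr q * (a powr q + 1)"
proof -
  have "(a + b) powr q \<le> (2 * max a 1) powr q" using assms by (intro powr_mono2) auto
  also have "\<dots> = 2 powr q * max a 1 powr q" by (simp add: powr_mult)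
  also have "\<dots> \<le> 2 powr q * (a powr q + 1)" by (intro mult_left_mono) (auto simp: max_def)
  finally show ?thesis .
qed

lemma (in finite_measure) nn_integral_abs_add_powr_tendsto:
  fixes f :: "'a \<Rightarrow> real"
  assumes [measurable]: "f \<in> borel_measurable M" and q: "0 < q"
    and finite: "(\<integral>\<^sup>+x. ennreal (\<bar>f x\<bar> powr q) \<partial>M) < \<infinity>"
    and e: "\<And>j. 0 \<le> e j" "\<And>j. e j \<le> 1" "e \<longlonglongrightarrow> 0"
  shows "(\<lambda>j. \<integral>\<^sup>+x. ennreal ((\<bar>f x\<bar> + e j) powr q) \<partial>M) \<longlonglongrightarrow> (\<integral>\<^sup>+x. ennreal (\<bar>f x\<bar> powr q) \<partial>M)"
proof (rule nn_integral_dominated_convergence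
    [where w = "\<lambda>x. ennreal (2 powr q) * (ennreal (\<bar>f x\<bar> powr q) + 1)"])
  show "(\<integral>\<^sup>+x. ennreal (2 powr q) * (ennreal (\<bar>f x\<bar> powr q) + 1) \<partial>M) < \<infinity>"
    using finite
    by (simp add: nn_integral_cmult nn_integral_add ennreal_mult_eq_top_iff less_top[symmetric])
  have "ennreal ((\<bar>f x\<bar> + e j) powr q) \<le> ennreal (2 powr q) * (ennreal (\<bar>f x\<bar> powr q) + 1)" for j x
    using add_powr_le[of "\<bar>f x\<bar>" "e j" q] e(1,2)[of j] q
    by (simp add: ennreal_leI flip: ennreal_1 ennreal_plus ennreal_mult)
  then show "AE x in M. ennreal ((\<bar>f x\<bar> + e j) powr q)
      \<le> ennreal (2 powr q) * (ennreal (\<bar>f x\<bar> powr q) + 1)" for j by simp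
  have "(\<lambda>j. (\<bar>f x\<bar> + e j) powr q) \<longlonglongrightarrow> (\<bar>f x\<bar> + 0) powr q" for x
    using e q by (intro tendsto_powr' tendsto_intros) auto
  then show "AE x in M. (\<lambda>j. ennreal ((\<bar>f x\<bar> + e j) powr q)) \<longlonglongrightarrow> ennreal (\<bar>f x\<bar> powr q)"
    by (intro AE_I2 tendsto_ennrealI) simp
qed measurable

definition moment_constant :: "nat \<Rightarrow> real" where
  "moment_constant n = real n * fact n / 4 ^ (n - 1)"

lemma moment_constant_nonneg: "0 \<le> moment_constant n"
  by (simp add: moment_constant_def)

lemma moment_constant_Suc:
  assumes "1 \<le> n"
  shows "moment_constant (Suc n) = (real (Suc n))\<^sup>2 / (4 * real n) * moment_constant n"
proof -
  have "4 * 4 ^ (n - 1) = (4::real) ^ n" using assms by (simp flip: power_Suc)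
  then show ?thesis using assms by (simp add: moment_constant_def power2_eq_square)
qed

lemma moment_constant_3_powr: "moment_constant 3 powr (1/3) = 3 powr (2/3) / 2"
proof -
  have "moment_constant 3 powr (1/3) = (9 / 8) powr (1/3)"
    by (simp add: moment_constant_def fact_numeral)
  also have "\<dots> = (3 powr 2) powr (1/3) / (2 powr 3) powr (1/3)"
    by (simp add: powr_divide)
  also have "\<dots> = 3 powr (2/3) / (2 :: real)" by (simp only: powr_powr) simp
  finally show ?thesis .
qed

locale poincare_torsion = poincare_domain \<Omega> c for \<Omega> :: "(real^'m) set" and c +
  fixes v :: "real^'m \<Rightarrow> real" and G :: "real^'m \<Rightarrow> real^'m"
  assumes v_H01: "H01 \<Omega> v G"
    and weak_equation: "H01 \<Omega> \<phi> K \<Longrightarrow>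
          (\<integral>x. G x \<bullet> K x \<partial>lebesgue_on \<Omega>) = (\<integral>x. \<phi> x \<partial>lebesgue_on \<Omega>)"
begin

definition moment :: "real \<Rightarrow> ennreal" where
  "moment p = (\<integral>\<^sup>+x. ennreal (\<bar>v x\<bar> powr p) \<partial>lebesgue_on \<Omega>)"

definition regularized_moment :: "real \<Rightarrow> real \<Rightarrow> ennreal" where
  "regularized_moment p e =
     (\<integral>\<^sup>+x. ennreal (\<bar>v x\<bar> powr p / sqrt (1 + e * (v x)\<^sup>2) powr (p - 2)) \<partial>lebesgue_on \<Omega>)"

lemma v_square_integrable: "square_integrable (lebesgue_on \<Omega>) v"
  by (rule H01_square_integrable_on(1)[OF v_H01 domain_sets])

lemma v_measurable [measurable]: "v \<in> borel_measurable (lebesgue_on \<Omega>)"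
  using v_square_integrable by measurable

lemma energy_inequality:
  assumes w: "smooth_real w" "\<And>t. \<bar>w t\<bar> \<le> B"
    and g: "\<And>t. DERIV g t :> w t" "g 0 = 0"
    and h: "\<And>t. DERIV h t :> (w t)\<^sup>2" "h 0 = 0"
  shows "ennreal c * (\<integral>\<^sup>+x. ennreal ((g (v x))\<^sup>2) \<partial>lebesgue_on \<Omega>)
    \<le> (\<integral>\<^sup>+x. ennreal (h (v x)) \<partial>lebesgue_on \<Omega>)"
proof -
  have g_comp: "H01 \<Omega> (\<lambda>x. g (v x)) (\<lambda>x. w (v x) *\<^sub>R G x)" by (rule H01_comp[OF v_H01 g w])
  have "smooth_real (\<lambda>t. (w t)\<^sup>2)"
    unfolding power2_eq_square by (rule smooth_real_mult[OF w(1) w(1)])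
  moreover have "\<bar>(w t)\<^sup>2\<bar> \<le> B\<^sup>2" for t using power_mono[OF w(2)[of t], of 2] by simp
  ultimately have h_comp: "H01 \<Omega> (\<lambda>x. h (v x)) (\<lambda>x. (w (v x))\<^sup>2 *\<^sub>R G x)"
    by (rule H01_comp[OF v_H01 h])
  let ?I = "\<integral>x. (g (v x))\<^sup>2 \<partial>lebesgue_on \<Omega>"
  have "c * ?I \<le> (\<integral>x. (norm (w (v x) *\<^sub>R G x))\<^sup>2 \<partial>lebesgue_on \<Omega>)"
    by (rule poincare[OF g_comp])
  also have "\<dots> = (\<integral>x. G x \<bullet> ((w (v x))\<^sup>2 *\<^sub>R G x) \<partial>lebesgue_on \<Omega>)"
    by (simp add: power_mult_distrib power2_norm_eq_inner)
  also have "\<dots> = (\<integral>x. h (v x) \<partial>lebesgue_on \<Omega>)" by (rule weak_equation[OF h_comp])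
  finally have "ennreal (c * ?I) \<le> ennreal (\<integral>x. h (v x) \<partial>lebesgue_on \<Omega>)"
    by (rule ennreal_leI)
  also have "\<dots> \<le> (\<integral>\<^sup>+x. ennreal (h (v x)) \<partial>lebesgue_on \<Omega>)"
    by (rule ennreal_integral_le_nn_integral)
  finally show ?thesis
    using L2_sq_eq_integral[OF H01_square_integrable_on(1)[OF g_comp domain_sets]] c_pos
    by (simp add: L2_sq_def ennreal_mult)
qed

lemma regularized_moment_le:
  assumes e: "0 < e" "e \<le> 1" and p: "2 \<le> p"
  shows "ennreal c * regularized_moment p e \<le> ennreal (p\<^sup>2 / (4 * (p - 1))) *
    (\<integral>\<^sup>+x. ennreal ((\<bar>v x\<bar> + e) powr (p - 1)) \<partial>lebesgue_on \<Omega>)"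
proof -
  define C where "C = p\<^sup>2 / (4 * (p - 1))"
  have "0 \<le> C" using p by (simp add: C_def)
  note w_smooth = smooth_real_moment_weight[OF e(1), of p]
  obtain g where g: "\<And>t. DERIV g t :> moment_weight p e t" "g 0 = 0"
    using antiderivative_exists[OF smooth_real_continuous[OF w_smooth]] by blast
  have "continuous_on UNIV (\<lambda>t. (moment_weight p e t)\<^sup>2)"
    by (intro continuous_intros smooth_real_continuous[OF w_smooth])
  then obtain h where h: "\<And>t. DERIV h t :> (moment_weight p e t)\<^sup>2" "h 0 = 0"
    using antiderivative_exists by blast
  have "regularized_moment p e \<le> (\<integral>\<^sup>+x. ennreal ((g (v x))\<^sup>2) \<partial>lebesgue_on \<Omega>)"
    unfolding regularized_moment_def
    by (intro nn_integral_mono ennreal_leI moment_weight_antiderivative_sq_ge[OF e(1) p g])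
  then have "ennreal c * regularized_moment p e
      \<le> ennreal c * (\<integral>\<^sup>+x. ennreal ((g (v x))\<^sup>2) \<partial>lebesgue_on \<Omega>)"
    by (rule mult_left_mono) simp
  also have "\<dots> \<le> (\<integral>\<^sup>+x. ennreal (h (v x)) \<partial>lebesgue_on \<Omega>)"
    by (rule energy_inequality[OF w_smooth moment_weight_bounded[OF e p] g h])
  also have "\<dots> \<le> (\<integral>\<^sup>+x. ennreal (C * (\<bar>v x\<bar> + e) powr (p - 1)) \<partial>lebesgue_on \<Omega>)"
    unfolding C_def
    by (intro nn_integral_mono ennreal_leI moment_weight_sq_antiderivative_le[OF e(1) p h])
  also have "\<dots> = ennreal C * (\<integral>\<^sup>+x. ennreal ((\<bar>v x\<bar> + e) powr (p - 1)) \<partial>lebesgue_on \<Omega>)"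
    using \<open>0 \<le> C\<close> by (simp add: ennreal_mult nn_integral_cmult)
  finally show ?thesis unfolding C_def .
qed

lemma moment_le_liminf_regularized_moment:
  assumes e: "\<And>j. 0 < e j" "e \<longlonglongrightarrow> 0"
  shows "moment p \<le> liminf (\<lambda>j. regularized_moment p (e j))"
proof -
  have "(\<lambda>j. \<bar>v x\<bar> powr p / sqrt (1 + e j * (v x)\<^sup>2) powr (p - 2))
      \<longlonglongrightarrow> \<bar>v x\<bar> powr p / sqrt (1 + 0 * (v x)\<^sup>2) powr (p - 2)" for x
    by (intro tendsto_intros e(2)) auto
  then have "moment p = (\<integral>\<^sup>+x. liminf (\<lambda>j.
      ennreal (\<bar>v x\<bar> powr p / sqrt (1 + e j * (v x)\<^sup>2) powr (p - 2))) \<partial>lebesgue_on \<Omega>)"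
    unfolding moment_def
    by (intro nn_integral_cong lim_imp_Liminf[symmetric] tendsto_ennrealI) simp_all
  also have "\<dots> \<le> liminf (\<lambda>j. regularized_moment p (e j))"
    unfolding regularized_moment_def by (intro nn_integral_liminf) measurable
  finally show ?thesis .
qed

lemma moment_recursion:
  assumes p: "2 \<le> p"
  shows "ennreal c * moment p \<le> ennreal (p\<^sup>2 / (4 * (p - 1))) * moment (p - 1)"
proof (cases "moment (p - 1) < \<infinity>")
  case True
  let ?C = "ennreal (p\<^sup>2 / (4 * (p - 1)))" and ?e = "\<lambda>j. 1 / real (Suc j)"
  have e: "?e \<longlonglongrightarrow> 0" using LIMSEQ_inverse_real_of_nat by (simp add: inverse_eq_divide)
  have "ennreal c * moment p \<le> ennreal c * liminf (\<lambda>j. regularized_moment p (?e j))"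
    by (intro mult_left_mono moment_le_liminf_regularized_moment e) auto
  also have "\<dots> = liminf (\<lambda>j. ennreal c * regularized_moment p (?e j))"
    by (rule Liminf_compose_continuous_mono[where f = "\<lambda>a. ennreal c * a", symmetric])
      (auto simp: mono_def intro!: ennreal_continuous_on_cmult continuous_on_id mult_left_mono)
  also have "\<dots> \<le> liminf
      (\<lambda>j. ?C * (\<integral>\<^sup>+x. ennreal ((\<bar>v x\<bar> + ?e j) powr (p - 1)) \<partial>lebesgue_on \<Omega>))"
    using p by (intro Liminf_mono always_eventually allI regularized_moment_le) auto
  also have "\<dots> = ?C * moment (p - 1)"
    using p True unfolding moment_def
    by (intro lim_imp_Liminf ennreal_tendsto_cmult nn_integral_abs_add_powr_tendsto e) auto
  finally show ?thesis .
next
  case False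
  then show ?thesis using p by (simp add: not_less top_unique ennreal_mult_top)
qed

lemma first_moment_le: "ennreal c * moment 1 \<le> emeasure lebesgue \<Omega>"
proof -
  have "square_integrable (lebesgue_on \<Omega>) (\<lambda>x. \<bar>v x\<bar>)"
    by (rule square_integrable_norm_le[OF v_square_integrable, where B = 1]) auto
  note Cauchy_Schwarz = integral_sq_le[OF this]
  define A where "A = (\<integral>x. \<bar>v x\<bar> \<partial>lebesgue_on \<Omega>)"
  have "integrable (lebesgue_on \<Omega>) v"
    by (rule square_integrable_imp_integrable[OF v_square_integrable])
  then have A: "moment 1 = ennreal A" "(\<integral>x. v x \<partial>lebesgue_on \<Omega>) \<le> A"
    unfolding A_def moment_def by (auto intro!: nn_integral_eq_integral integral_mono)
  have "0 \<le> A" by (simp add: A_def)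
  have "A * (c * A) = c * A\<^sup>2" by (simp add: power2_eq_square)
  also have "\<dots> \<le> c * (measure lebesgue \<Omega> * (\<integral>x. (v x)\<^sup>2 \<partial>lebesgue_on \<Omega>))"
    using Cauchy_Schwarz c_pos by (simp add: A_def measure_domain)
  also have "\<dots> = measure lebesgue \<Omega> * (c * (\<integral>x. (v x)\<^sup>2 \<partial>lebesgue_on \<Omega>))" by simp
  also have "\<dots> \<le> measure lebesgue \<Omega> * (\<integral>x. v x \<partial>lebesgue_on \<Omega>)"
    using poincare[OF v_H01] weak_equation[OF v_H01]
    by (intro mult_left_mono) (simp_all add: power2_norm_eq_inner)
  also have "\<dots> \<le> measure lebesgue \<Omega> * A" using A(2) by (intro mult_left_mono) auto
  also have "\<dots> = A * measure lebesgue \<Omega>" by simp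
  finally have "A = 0 \<or> c * A \<le> measure lebesgue \<Omega>"
    using \<open>0 \<le> A\<close> by (auto simp: mult_le_cancel_left)
  then have "c * A \<le> measure lebesgue \<Omega>" by auto
  then show ?thesis
    using c_pos \<open>0 \<le> A\<close> domain_lmeasurable
    by (simp add: A(1) emeasure_eq_measure2 ennreal_leI flip: ennreal_mult)
qed

lemma moment_bound:
  assumes "1 \<le> n"
  shows "ennreal (c ^ n) * moment (real n) \<le> ennreal (moment_constant n) * emeasure lebesgue \<Omega>"
  using assms
proof (induction n rule: nat_induct_at_least)
  case base
  then show ?case using first_moment_le by (simp add: moment_constant_def)
next
  case (Suc n)
  let ?C = "(real (Suc n))\<^sup>2 / (4 * real n)"
  have "ennreal (c ^ Suc n) * moment (real (Suc n))
      = ennreal (c ^ n) * (ennreal c * moment (real (Suc n)))"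
    using c_pos by (simp add: ennreal_mult mult_ac)
  also have "\<dots> \<le> ennreal (c ^ n) * (ennreal ?C * moment (real n))"
    using moment_recursion[of "real (Suc n)"] Suc.hyps by (intro mult_left_mono) auto
  also have "\<dots> = ennreal ?C * (ennreal (c ^ n) * moment (real n))" by (simp add: mult_ac)
  also have "\<dots> \<le> ennreal ?C * (ennreal (moment_constant n) * emeasure lebesgue \<Omega>)"
    by (intro mult_left_mono Suc.IH) simp
  also have "\<dots> = ennreal (?C * moment_constant n) * emeasure lebesgue \<Omega>"
    by (simp only: ennreal_mult''[OF moment_constant_nonneg] mult.assoc)
  also have "?C * moment_constant n = moment_constant (Suc n)"
    by (rule moment_constant_Suc[OF Suc.hyps, symmetric])
  finally show ?case .
qed

lemma Lp_norm_le:
  assumes n: "1 \<le> n"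
  shows "c * Lp_norm (real n) \<Omega> v \<le> (moment_constant n * measure lebesgue \<Omega>) powr (1 / real n)"
proof -
  let ?A = "enn2real (moment (real n))"
  have "enn2real (ennreal (c ^ n) * moment (real n))
      \<le> enn2real (ennreal (moment_constant n) * emeasure lebesgue \<Omega>)"
    using domain_lmeasurable by (intro enn2real_mono moment_bound n)
      (auto simp: ennreal_mult_less_top fmeasurable_def less_top)
  then have bound: "c ^ n * ?A \<le> moment_constant n * measure lebesgue \<Omega>"
    using c_pos by (simp add: enn2real_mult measure_def moment_constant_def)
  have "Lp_norm (real n) \<Omega> v = ?A powr (1 / real n)"
    using domain_sets by (simp add: Lp_norm_def moment_def nn_integral_restrict_space)
  moreover have "c = (c ^ n) powr (1 / real n)"
    using c_pos n by (simp add: powr_powr flip: powr_realpow)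
  ultimately have "c * Lp_norm (real n) \<Omega> v = (c ^ n * ?A) powr (1 / real n)"
    by (simp add: powr_mult)
  also have "\<dots> \<le> (moment_constant n * measure lebesgue \<Omega>) powr (1 / real n)"
    using bound c_pos by (intro powr_mono2) auto
  finally show ?thesis .
qed

end

lemma (in poincare_domain) Lp_norm_torsion_le:
  assumes "1 \<le> n"
  shows "c * Lp_norm (real n) \<Omega> (torsion \<Omega>)
    \<le> (moment_constant n * measure lebesgue \<Omega>) powr (1 / real n)"
proof -
  have "is_torsion \<Omega> (torsion \<Omega>)" unfolding torsion_def by (rule someI_ex[OF torsion_exists])
  then obtain G where "poincare_torsion \<Omega> c (torsion \<Omega>) G"
    unfolding is_torsion_def set_integral_eq_lebesgue_on[OF domain_sets]
    using poincare_domain_axioms by (auto simp: poincare_torsion_def poincare_torsion_axioms_def)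
  then show ?thesis by (rule poincare_torsion.Lp_norm_le[OF _ assms])
qed

section \<open>The first eigenvalue\<close>

lemma lambda1_times_le:
  assumes \<Omega>: "\<Omega> \<in> sets lebesgue" and H: "H01 \<Omega> \<phi> G"
  shows "lambda1 \<Omega> * (\<integral>x. (\<phi> x)\<^sup>2 \<partial>lebesgue_on \<Omega>) \<le> (\<integral>x. (norm (G x))\<^sup>2 \<partial>lebesgue_on \<Omega>)"
proof (cases "(\<integral>x. (\<phi> x)\<^sup>2 \<partial>lebesgue_on \<Omega>) = 0")
  case False
  then have pos: "0 < (\<integral>x. (\<phi> x)\<^sup>2 \<partial>lebesgue_on \<Omega>)"
    by (simp add: order_less_le)
  then have "(\<integral>\<^sup>+x\<in>\<Omega>. ennreal ((\<phi> x)\<^sup>2) \<partial>lebesgue) \<noteq> 0"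
    using L2_sq_eq_integral[OF H01_square_integrable_on(1)[OF H \<Omega>]] \<Omega>
    by (simp add: L2_sq_def nn_integral_restrict_space)
  then have "lambda1 \<Omega> \<le> (\<integral>x. (norm (G x))\<^sup>2 \<partial>lebesgue_on \<Omega>) / (\<integral>x. (\<phi> x)\<^sup>2 \<partial>lebesgue_on \<Omega>)"
    unfolding lambda1_def set_integral_eq_lebesgue_on[OF \<Omega>]
    using H by (intro cInf_lower bdd_belowI[of _ 0]) auto
  then show ?thesis using pos by (simp add: pos_le_divide_eq)
qed simp

lemma poincare_domain_lambda1:
  assumes "\<Omega> \<in> lmeasurable" "0 < lambda1 \<Omega>"
  shows "poincare_domain \<Omega> (lambda1 \<Omega>)"
  using assms by unfold_locales (auto intro: lambda1_times_le fmeasurableD)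

theorem F_fun_le:
  assumes \<Omega>: "\<Omega> \<in> lmeasurable" and n: "1 \<le> n"
  shows "F_fun (real n) \<Omega> \<le> moment_constant n powr (1 / real n)"
proof (cases "0 < lambda1 \<Omega>")
  case True
  let ?K = "moment_constant n" and ?m = "measure lebesgue \<Omega>"
  have "F_fun (real n) \<Omega> \<le> (?K * ?m) powr (1 / real n) / ?m powr (1 / real n)"
    using poincare_domain.Lp_norm_torsion_le[OF poincare_domain_lambda1[OF \<Omega> True] n]
    unfolding F_fun_def by (intro divide_right_mono) (simp_all add: mult.commute)
  also have "\<dots> = ?K powr (1 / real n) * (?m powr (1 / real n) / ?m powr (1 / real n))"
    by (simp only: powr_mult times_divide_eq_right)
  also have "\<dots> \<le> ?K powr (1 / real n) * 1" by (intro mult_left_mono) auto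
  finally show ?thesis by simp
next
  case False
  then have "F_fun (real n) \<Omega> \<le> 0"
    by (auto simp: F_fun_def Lp_norm_def intro!: divide_nonpos_nonneg mult_nonneg_nonpos)
  also have "0 \<le> moment_constant n powr (1 / real n)" by simp
  finally show ?thesis .
qed

lemma frakF_le:
  assumes "1 \<le> n"
  shows "frakF TYPE('m::finite) (real n) \<le> ereal (moment_constant n powr (1 / real n))"
  unfolding frakF_def
proof (rule Sup_least, clarify)
  fix \<Omega> :: "(real^'m) set"
  assume "open \<Omega>" "emeasure lebesgue \<Omega> < \<infinity>"
  then have "\<Omega> \<in> lmeasurable" by (intro fmeasurableI) auto
  then show "ereal (F_fun (real n) \<Omega>) \<le> ereal (moment_constant n powr (1 / real n))"
    by (simp only: ereal_less_eq F_fun_le[OF _ assms])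
qed

theorem theorem3:
  assumes "CARD('m::finite) \<ge> 2"
  shows "(\<forall>n::nat. n \<ge> 1 \<longrightarrow>
           frakF TYPE('m) (real n) \<le> ereal ((real n * fact n / 4 ^ (n - 1)) powr (1 / real n)))
         \<and> frakF TYPE('m) 3 \<le> ereal (3 powr (2/3) / 2)"
proof (intro conjI allI impI)
  fix n :: nat
  assume "n \<ge> 1"
  then show "frakF TYPE('m) (real n) \<le> ereal ((real n * fact n / 4 ^ (n - 1)) powr (1 / real n))"
    by (rule frakF_le[unfolded moment_constant_def])
next
  show "frakF TYPE('m) 3 \<le> ereal (3 powr (2/3) / 2)"
    using frakF_le[of 3] by (simp add: moment_constant_3_powr)
qed

end
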